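(* For every $c \in \{0\} \cup \mathbb{N}_{\ge 3}$ and every $d \in \mathbb{N}$, there exists a positive algebraic number $\alpha$ such that the additive monoid $\mathbb{N}_0[\alpha]$ is an atomic monoid of rank $d$ with catenary degree $\mathsf{c}(\mathbb{N}_0[\alpha]) = c$. Moreover, for any $c \in \mathbb{N}_{\ge 3}$ and $d \in \mathbb{N}$ the following statements hold. (1) There exists a positive algebraic number $\alpha$ such that $\mathbb{N}_0[\alpha]$ has rank $d$, satisfies the ACCP, and $\mathsf{c}(\mathbb{N}_0[\alpha]) = c$. (2) If $c \in \mathbb{N}$, then there exists a positive algebraic number $\alpha$ such that $\mathbb{N}_0[\alpha]$ has rank $d$, is atomic, does not satisfy the ACCP, and $\mathsf{c}(\mathbb{N}_0[\alpha]) = c$.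
   Context: $\mathbb{N}$ is the set of positive integers, $\mathbb{N}_0 = \mathbb{N} \cup \{0\}$, and $\mathbb{N}_{\ge 3} = \{n \in \mathbb{N} \mid n \ge 3\}$. For a positive real $\alpha$, $\mathbb{N}_0[\alpha] = \{p(\alpha) \mid p(X) \in \mathbb{N}_0[X]\}$, where $\mathbb{N}_0[X]$ is the set of polynomials with nonnegative integer coefficients; it is regarded as a monoid under addition. Algebraic means algebraic over $\mathbb{Q}$; positive algebraic numbers are real. Let $M = \mathbb{N}_0[\alpha]$. The rank of $M$ is the dimension of the $\mathbb{Q}$-vector space $\mathbb{Q} \otimes_{\mathbb{Z}} \mathrm{gp}(M)$, where $\mathrm{gp}(M)$ is the group of differences of elements of $M$. An atom of $M$ is a nonzero element that is not the sum of two nonzero elements of $M$. $M$ is atomic if every nonzero element is a sum of finitely many atoms. $M$ satisfies the ACCP if every ascending chain of principal ideals $b_1 + M \subseteq b_2 + M \subseteq \cdots$ (with $b_i \in M$) eventually stabilizes; every monoid satisfying the ACCP is atomic. Suppose $M$ is atomic. A factorization of $b \in M$ is a formal sum (finite multiset) of atoms of $M$ whose actual sum is $b$; $\mathsf{Z}(b)$ is the set of all factorizations of $b$, and $|z|$ is the number of atoms in a factorization $z$, counting repetitions. For factorizations $z = \sum_a \mu_a a$ and $z' = \sum_a \nu_a a$, set $\gcd(z,z') = \sum_a \min\{\mu_a,\nu_a\} a$ and $\mathsf{d}(z,z') = \max\{|z| - |\gcd(z,z')|, |z'| - |\gcd(z,z')|\}$. For $N \in \mathbb{N}_0 \cup \{\infty\}$,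 an $N$-chain of factorizations connecting $z, z' \in \mathsf{Z}(b)$ is a finite sequence $z = z_0, z_1, \dots, z_k = z'$ in $\mathsf{Z}(b)$ with $\mathsf{d}(z_{i-1}, z_i) \le N$ for every $i \in \{1,\dots,k\}$. The catenary degree $\mathsf{c}(b)$ of $b \in M$ is the smallest $n \in \mathbb{N}_0 \cup \{\infty\}$ such that any two factorizations in $\mathsf{Z}(b)$ are connected by an $n$-chain of factorizations, and the catenary degree of $M$ is $\mathsf{c}(M) = \sup\{\mathsf{c}(b) \mid b \in M\} \in \mathbb{N}_0 \cup \{\infty\}$. *)

theory Defs
  imports
    "HOL-Algebra.Free_Abelian_Groups"
    "HOL-Library.Extended_Nat"
    "HOL-Library.Multiset"
    "HOL-Computational_Algebra.Polynomial"
    "Jordan_Normal_Form.VS_Connect"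
begin

definition nat_eval_monoid :: "real \<Rightarrow> real set" where
  "nat_eval_monoid \<alpha> = range (\<lambda>p :: nat poly. poly (map_poly real p) \<alpha>)"


text \<open>
  In the definitions below, a monoid is a set \<open>M\<close> of elements of an additive type class,
  containing \<open>0\<close> and closed under \<open>+\<close>. Only reduced monoids (those whose only unit is \<open>0\<close>) are
  considered, so atoms need not be taken up to associates.
\<close>

definition atoms :: "'a :: comm_monoid_add set \<Rightarrow> 'a set" where
  "atoms M = {a \<in> M. a \<noteq> 0 \<and> \<not> (\<exists>x \<in> M. \<exists>y \<in> M. x \<noteq> 0 \<and> y \<noteq> 0 \<and> a = x + y)}"

definition factorizations :: "'a :: comm_monoid_add set \<Rightarrow> 'a \<Rightarrow> 'a multiset set" where
  "factorizations M b = {z. set_mset z \<subseteq> atoms M \<and> sum_mset z = b}"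

definition atomic :: "'a :: comm_monoid_add set \<Rightarrow> bool" where
  "atomic M \<longleftrightarrow> (\<forall>b \<in> M. b \<noteq> 0 \<longrightarrow> factorizations M b \<noteq> {})"

definition principal_ideal :: "'a :: comm_monoid_add set \<Rightarrow> 'a \<Rightarrow> 'a set" where
  "principal_ideal M b = (\<lambda>x. b + x) ` M"

definition ACCP :: "'a :: comm_monoid_add set \<Rightarrow> bool" where
  "ACCP M \<longleftrightarrow>
     (\<forall>b :: nat \<Rightarrow> 'a. range b \<subseteq> M
        \<and> (\<forall>i. principal_ideal M (b i) \<subseteq> principal_ideal M (b (Suc i)))
      \<longrightarrow> (\<exists>N. \<forall>i\<ge>N. principal_ideal M (b i) = principal_ideal M (b N)))"

text \<open>The greatest common divisor of two factorizations is their multiset intersection \<open>\<inter>#\<close>.\<close>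

definition fact_dist :: "'a multiset \<Rightarrow> 'a multiset \<Rightarrow> nat" where
  "fact_dist z z' = max (size z - size (z \<inter># z')) (size z' - size (z \<inter># z'))"

definition chain_connected ::
    "'a :: comm_monoid_add set \<Rightarrow> 'a \<Rightarrow> enat \<Rightarrow> 'a multiset \<Rightarrow> 'a multiset \<Rightarrow> bool" where
  "chain_connected M b N z z' \<longleftrightarrow>
     (\<exists>(k :: nat) (c :: nat \<Rightarrow> 'a multiset).
        c 0 = z \<and> c k = z'
        \<and> (\<forall>i\<le>k. c i \<in> factorizations M b)
        \<and> (\<forall>i\<in>{1..k}. enat (fact_dist (c (i - 1)) (c i)) \<le> N))"

text \<open>The \<open>LEAST\<close> exists because any two factorizations are connected by an \<open>\<infinity>\<close>-chain.\<close>

definition catenary_degree_elem :: "'a :: comm_monoid_add set \<Rightarrow> 'a \<Rightarrow> enat" where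
  "catenary_degree_elem M b =
     (LEAST n. \<forall>z \<in> factorizations M b. \<forall>z' \<in> factorizations M b. chain_connected M b n z z')"

definition catenary_degree :: "'a :: comm_monoid_add set \<Rightarrow> enat" where
  "catenary_degree M = (SUP b \<in> M. catenary_degree_elem M b)"


definition gp :: "'a :: ab_group_add set \<Rightarrow> 'a set" where
  "gp M = {x - y | x y. x \<in> M \<and> y \<in> M}"

text \<open>
  The tensor product \<open>\<rat> \<otimes>\<^sub>\<int> G\<close> of \<open>\<rat>\<close> with a subgroup \<open>G\<close>: the free abelian group on the symbols
  \<open>(q, g)\<close>, standing for \<open>q \<otimes> g\<close>, modulo the subgroup generated by the biadditivity relations
  (which imply that integers can be moved across \<open>\<otimes>\<close>). The scalar \<open>r\<close> acts by
  \<open>r \<cdot> (q \<otimes> g) = (r * q) \<otimes> g\<close>; in \<open>smult\<close> below, the image of a coset under the induced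
  endomorphism of the free group is saturated by the relation subgroup, so that it is a full coset.
\<close>

definition free_tensor :: "'a set \<Rightarrow> ((rat \<times> 'a) \<Rightarrow>\<^sub>0 int) monoid" where
  "free_tensor G = free_Abelian_group (UNIV \<times> G)"

definition tensor_relations :: "'a :: ab_group_add set \<Rightarrow> ((rat \<times> 'a) \<Rightarrow>\<^sub>0 int) set" where
  "tensor_relations G = generate (free_tensor G)
     ({frag_of (q + r, g) - frag_of (q, g) - frag_of (r, g) | q r g. g \<in> G} \<union>
      {frag_of (q, g + h) - frag_of (q, g) - frag_of (q, h) | q g h. g \<in> G \<and> h \<in> G})"

definition rat_scale :: "rat \<Rightarrow> ((rat \<times> 'a) \<Rightarrow>\<^sub>0 int) \<Rightarrow> ((rat \<times> 'a) \<Rightarrow>\<^sub>0 int)" where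
  "rat_scale r = frag_extend (\<lambda>(q, g). frag_of (r * q, g))"

definition rat_tensor ::
    "'a :: ab_group_add set \<Rightarrow> (rat, ((rat \<times> 'a) \<Rightarrow>\<^sub>0 int) set) module" where
  "rat_tensor G =
     (let T = free_tensor G Mod tensor_relations G in
      \<lparr>carrier = carrier T,
       monoid.mult = undefined, one = undefined,
       ring.zero = one T, add = monoid.mult T,
       smult = (\<lambda>r X. tensor_relations G <#>\<^bsub>free_tensor G\<^esub>
                        rat_scale r ` X)\<rparr>)"

definition monoid_rank :: "'a :: ab_group_add set \<Rightarrow> enat" where
  "monoid_rank M =
     (if vectorspace.fin_dim class_ring (rat_tensor (gp M))
      then enat (vectorspace.dim class_ring (rat_tensor (gp M))) else \<infinity>)"

text \<open>
  The rest of this theory checks that \<open>rat_tensor\<close> satisfies the vector space axioms, so that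
  \<open>vectorspace.fin_dim\<close> and \<open>vectorspace.dim\<close> have their usual meaning in \<open>monoid_rank\<close>.
\<close>

lemma rat_scale_simps [simp]:
  "rat_scale r 0 = 0" "rat_scale r (frag_of (q,g)) = frag_of (r*q,g)"
  "rat_scale r (x+y) = rat_scale r x + rat_scale r y"
  "rat_scale r (x - y) = rat_scale r x - rat_scale r y" "rat_scale r (-x) = - rat_scale r x"
  by (simp_all add: rat_scale_def frag_extend_add frag_extend_diff frag_extend_minus)

context
  fixes G :: "'a::ab_group_add set"
  assumes G: "\<And>x y. x \<in> G \<Longrightarrow> y \<in> G \<Longrightarrow> x + y \<in> G"
begin

private abbreviation "F \<equiv> free_tensor G"
private abbreviation "K \<equiv> tensor_relations G"
private abbreviation "R \<equiv> {frag_of (q + r, g) - frag_of (q, g) - frag_of (r, g) | q r g. g \<in> G} \<union>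
      {frag_of (q, g + h) - frag_of (q, g) - frag_of (q, h) | q g h. g \<in> G \<and> h \<in> G}"

lemma free_tensor_carrier: "carrier F = {x. Poly_Mapping.keys x \<subseteq> UNIV \<times> G}"
  by (simp add: free_tensor_def free_Abelian_group_def)
lemma free_tensor_mult [simp]: "x \<otimes>\<^bsub>F\<^esub> y = x + y" and free_tensor_one [simp]: "\<one>\<^bsub>F\<^esub> = 0"
  by (simp_all add: free_tensor_def free_Abelian_group_def)

interpretation F: comm_group F
  unfolding free_tensor_def by (rule abelian_free_Abelian_group)

lemma free_tensor_inv [simp]: "x \<in> carrier F \<Longrightarrow> inv\<^bsub>F\<^esub> x = - x"
  unfolding free_tensor_def by (subst inv_free_Abelian_group) (auto simp: free_Abelian_group_def)

lemma frag_of_in_free_tensor [simp]: "frag_of (q,g) \<in> carrier F \<longleftrightarrow> g \<in> G"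
  by (auto simp: free_tensor_carrier)

lemma free_tensor_diff: "x \<in> carrier F \<Longrightarrow> y \<in> carrier F \<Longrightarrow> x - y \<in> carrier F"
  using F.m_closed[of x "inv\<^bsub>F\<^esub> y"] F.inv_closed[of y] by simp

lemma tensor_generators_subset: "R \<subseteq> carrier F"
  by (auto intro!: free_tensor_diff G)

lemma subgroup_tensor_relations: "subgroup K F"
  unfolding tensor_relations_def by (rule F.generate_is_subgroup[OF tensor_generators_subset])

lemma normal_tensor_relations: "K \<lhd> F"
  using subgroup_tensor_relations by (simp add: F.normal_iff_subgroup)

lemma tensor_relations_0: "0 \<in> K" using subgroup.one_closed[OF subgroup_tensor_relations] by simp
lemma tensor_relations_add: "x \<in> K \<Longrightarrow> y \<in> K \<Longrightarrow> x + y \<in> K" using subgroup.m_closed[OF subgroup_tensor_relations] by simp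
lemma tensor_relations_in_free: "x \<in> K \<Longrightarrow> x \<in> carrier F" using subgroup.subset[OF subgroup_tensor_relations] by auto
lemma tensor_relations_uminus: "x \<in> K \<Longrightarrow> - x \<in> K" using subgroup.m_inv_closed[OF subgroup_tensor_relations, of x] tensor_relations_in_free[of x] by simp
lemma tensor_relations_diff: "x \<in> K \<Longrightarrow> y \<in> K \<Longrightarrow> x - y \<in> K" using tensor_relations_add[OF _ tensor_relations_uminus, of x y] by simp

lemma rat_scale_free_tensor: "x \<in> carrier F \<Longrightarrow> rat_scale r x \<in> carrier F"
  unfolding free_tensor_carrier mem_Collect_eq
proof (induction x rule: frag_induction)
  case (one a) then show ?case by (cases a) auto
next case (diff x y) thus ?case using free_tensor_diff[unfolded free_tensor_carrier] by simp
qed auto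

lemma rat_scale_tensor_relations: "x \<in> K \<Longrightarrow> rat_scale r x \<in> K"
  unfolding tensor_relations_def
proof (induction x rule: generate.induct)
  case one then show ?case using tensor_relations_0[unfolded tensor_relations_def] by simp
next
  case (incl h)
  have "rat_scale r h \<in> R" using incl by (force simp: distrib_left)
  thus ?case by (rule generate.incl)
next
  case (inv h)
  have "rat_scale r h \<in> R" using inv by (force simp: distrib_left)
  hence "rat_scale r h \<in> K" unfolding tensor_relations_def by (rule generate.incl)
  have "h \<in> carrier F" using inv tensor_generators_subset by blast
  hence "inv\<^bsub>F\<^esub> h = - h" by (rule free_tensor_inv)
  with tensor_relations_uminus[OF \<open>rat_scale r h \<in> K\<close>] show ?case by (simp add: tensor_relations_def)
next
  case (eng h1 h2) thus ?case using tensor_relations_add[unfolded tensor_relations_def] by simp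
qed

lemma rat_scale_distrib: "x \<in> carrier F \<Longrightarrow> rat_scale (r+s) x - (rat_scale r x + rat_scale s x) \<in> K"
  unfolding free_tensor_carrier mem_Collect_eq
proof (induction x rule: frag_induction)
  case (one a)
  obtain q g where a: "a = (q,g)" by (cases a)
  have "frag_of (r*q + s*q, g) - frag_of (r*q,g) - frag_of (s*q,g) \<in> K"
    unfolding tensor_relations_def by (rule generate.incl) (use one a in auto)
  thus ?case by (simp add: a distrib_right algebra_simps)
next case (diff x y) from tensor_relations_diff[OF diff.IH] show ?case by (simp add: algebra_simps)
qed (simp add: tensor_relations_0)

lemma rat_scale_assoc: "rat_scale (r*s) x = rat_scale r (rat_scale s x)"
  by (rule frag_induction[where S=UNIV and P="\<lambda>x. rat_scale (r*s) x = rat_scale r (rat_scale s x)"]) (auto simp: mult.assoc)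
lemma rat_scale_one: "rat_scale 1 x = x"
  by (rule frag_induction[where S=UNIV and P="\<lambda>x. rat_scale 1 x = x"]) auto

lemma tensor_coset: "K #>\<^bsub>F\<^esub> x = {k + x |k. k \<in> K}"
  by (auto simp: r_coset_def)

lemma tensor_coset_eqI: "x - y \<in> K \<Longrightarrow> K #>\<^bsub>F\<^esub> x = K #>\<^bsub>F\<^esub> y"
proof -
  assume d: "x - y \<in> K"
  have "k + x \<in> K #>\<^bsub>F\<^esub> y" if "k \<in> K" for k
    using tensor_relations_add[OF that d] by (auto simp: tensor_coset intro!: exI[of _ "k + (x - y)"])
  moreover have "k + y \<in> K #>\<^bsub>F\<^esub> x" if "k \<in> K" for k
    using tensor_relations_diff[OF that d] by (auto simp: tensor_coset intro!: exI[of _ "k - (x - y)"])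
  ultimately show ?thesis by (auto simp: tensor_coset[of x] tensor_coset[of y])
qed

private abbreviation "V \<equiv> rat_tensor G"
lemma rat_tensor_carrier: "carrier V = {K #>\<^bsub>F\<^esub> x | x. x \<in> carrier F}"
  by (auto simp: rat_tensor_def Let_def FactGroup_def RCOSETS_def)
lemma rat_tensor_in_carrier: "y \<in> carrier F \<Longrightarrow> K #>\<^bsub>F\<^esub> y \<in> carrier V" by (auto simp: rat_tensor_carrier)
lemma rat_tensor_carrierE: "x \<in> carrier V \<Longrightarrow> (\<And>y. x = K #>\<^bsub>F\<^esub> y \<Longrightarrow> y \<in> carrier F \<Longrightarrow> P) \<Longrightarrow> P" by (auto simp: rat_tensor_carrier)
lemma rat_tensor_add: "x \<in> carrier F \<Longrightarrow> y \<in> carrier F \<Longrightarrow> (K #>\<^bsub>F\<^esub> x) \<oplus>\<^bsub>V\<^esub> (K #>\<^bsub>F\<^esub> y) = K #>\<^bsub>F\<^esub> (x+y)"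
  using normal.rcos_sum[OF normal_tensor_relations, of x y] by (simp add: rat_tensor_def Let_def FactGroup_def)
lemma rat_tensor_smult: "(r \<odot>\<^bsub>V\<^esub> (K #>\<^bsub>F\<^esub> x)) = K #>\<^bsub>F\<^esub> (rat_scale r x)"
proof -
  have "(r \<odot>\<^bsub>V\<^esub> (K #>\<^bsub>F\<^esub> x)) = K <#>\<^bsub>F\<^esub> rat_scale r ` (K #>\<^bsub>F\<^esub> x)"
    by (simp add: rat_tensor_def Let_def rat_scale_def)
  also have "\<dots> = {k + rat_scale r x | k. k \<in> K}"
  proof (intro equalityI subsetI)
    fix y assume "y \<in> K <#>\<^bsub>F\<^esub> rat_scale r ` (K #>\<^bsub>F\<^esub> x)"
    then obtain k k' where "k \<in> K" "k' \<in> K" "y = k + rat_scale r (k' + x)" by (auto simp: set_mult_def tensor_coset)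
    thus "y \<in> {k + rat_scale r x | k. k \<in> K}" using tensor_relations_add[OF _ rat_scale_tensor_relations, of k k'] by (auto intro!: exI[of _ "k + rat_scale r k'"] simp: add.assoc)
  next
    fix y assume "y \<in> {k + rat_scale r x | k. k \<in> K}"
    then obtain k where "k \<in> K" "y = k + rat_scale r (0 + x)" by auto
    thus "y \<in> K <#>\<^bsub>F\<^esub> rat_scale r ` (K #>\<^bsub>F\<^esub> x)" using tensor_relations_0 by (fastforce simp: set_mult_def tensor_coset)
  qed
  finally show ?thesis by (simp add: tensor_coset)
qed

lemma vectorspace_rat_tensor: "vectorspace class_ring (rat_tensor G)"
proof -
  have z: "\<zero>\<^bsub>V\<^esub> = K #>\<^bsub>F\<^esub> 0"
    by (simp add: rat_tensor_def Let_def FactGroup_def tensor_coset)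
  have ab: "abelian_group V"
  proof (rule abelian_groupI)
    fix x assume "x \<in> carrier V"
    then obtain y where y: "y \<in> carrier F" "x = K #>\<^bsub>F\<^esub> y" by (auto simp: rat_tensor_carrier)
    have my: "- y \<in> carrier F" using F.inv_closed[of y] y by simp
    show "\<exists>y\<in>carrier V. y \<oplus>\<^bsub>V\<^esub> x = \<zero>\<^bsub>V\<^esub>"
      by (rule bexI[of _ "K #>\<^bsub>F\<^esub> (- y)"]) (use y my in \<open>auto simp: rat_tensor_add z rat_tensor_carrier\<close>)
  qed (use F.m_closed F.one_closed in \<open>auto simp: rat_tensor_add z ac_simps elim!: rat_tensor_carrierE intro!: rat_tensor_in_carrier\<close>)
  have "Module.module class_ring V"
  proof (rule moduleI[OF class_cring.is_cring ab])
  qed (auto simp: rat_tensor_carrier rat_tensor_add rat_tensor_smult rat_scale_free_tensor rat_scale_assoc rat_scale_one tensor_coset_eqI[OF rat_scale_distrib])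
  thus ?thesis by (intro vectorspace.intro class_field)
qed
end

lemma vectorspace_rat_tensor_gp:
  assumes "\<And>x y. x \<in> M \<Longrightarrow> y \<in> M \<Longrightarrow> x + y \<in> M"
  shows "vectorspace class_ring (rat_tensor (gp M))"
proof (rule vectorspace_rat_tensor)
  fix x y assume "x \<in> gp M" "y \<in> gp M"
  then obtain a b c d where "x = a - b" "y = c - d" "a \<in> M" "b \<in> M" "c \<in> M" "d \<in> M"
    by (auto simp: gp_def)
  moreover have "a - b + (c - d) = (a + c) - (b + d)" by simp
  ultimately show "x + y \<in> gp M" using assms unfolding gp_def by blast
qed

end

theory Submission
  imports Defs "Jordan_Normal_Form.Char_Poly"
begin

text \<open>
  Take \<open>\<alpha>\<close> with \<open>\<alpha>\<^sup>d = p / r\<close> for consecutive positive integers \<open>p\<close> and \<open>r\<close>. Consecutive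
  integers are not both \<open>e\<close>-th powers for any \<open>e \<ge> 2\<close>, so \<open>r X\<^sup>d - p\<close> is irreducible (the complex
  roots of a proper factor all have modulus \<open>\<alpha>\<close>, and their product would make \<open>\<alpha>\<^sup>k\<close> rational for
  some \<open>0 < k < d\<close>); by Gauss's lemma every integer polynomial vanishing at \<open>\<alpha>\<close> is
  \<open>(r X\<^sup>d - p) g\<close> with \<open>g\<close> integral.

  If \<open>p, r \<ge> 2\<close>, then comparing the signs of the coefficients of \<open>g\<close> shows that every power of
  \<open>\<alpha>\<close> is an atom. The lowest and the highest coefficient of \<open>(r X\<^sup>d - p) g\<close> keep distinct
  factorizations at distance at least \<open>max p r\<close>, while trading \<open>p\<close> copies of \<open>\<alpha>\<^sup>i\<close> for \<open>r\<close>
  copies of \<open>\<alpha>\<^bsup>i + d\<^esup>\<close>, or conversely, connects them in steps of distance at most \<open>max p r\<close>. Hence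
  the catenary degree is \<open>max p r\<close>. The ACCP holds if \<open>p > r\<close>, as nonzero elements are then at
  least \<open>1\<close>, and fails if \<open>p < r\<close>, as witnessed by the chain generated by the \<open>p \<alpha>\<^bsup>i d\<^esup>\<close>. For
  \<open>p = 2\<close>, \<open>r = 1\<close> the monoid is free on \<open>1, \<alpha>, \<dots>, \<alpha>\<^bsup>d - 1\<^esup>\<close>.
\<close>

section \<open>Radicals of a quotient of consecutive integers\<close>

text \<open>Both sides come from equating two fractions in lowest terms, since coprimality of
  \<open>u\<close> and \<open>v\<close> passes to their powers; numerators and denominators then
  divide each other.\<close>

lemma coprime_power_eq_fraction:
  fixes u v p r e :: nat
  assumes "u ^ e * r = v ^ e * p" "coprime u v" "coprime p r"
  shows "u ^ e = p" "v ^ e = r"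
proof -
  have "coprime (u ^ e) (v ^ e)" using assms(2) by simp
  have "u ^ e dvd p"
    using assms(1) \<open>coprime (u ^ e) (v ^ e)\<close> by (metis coprime_dvd_mult_right_iff dvd_triv_left)
  moreover have "p dvd u ^ e"
    using assms(1,3) by (metis coprime_dvd_mult_left_iff dvd_triv_right)
  ultimately show "u ^ e = p" by (rule dvd_antisym)
  have "v ^ e dvd r"
    using assms(1) \<open>coprime (u ^ e) (v ^ e)\<close>
    by (metis coprime_commute coprime_dvd_mult_right_iff dvd_triv_left)
  moreover have "r dvd v ^ e"
    using assms(1,3) by (metis coprime_commute coprime_dvd_mult_left_iff dvd_triv_right)
  ultimately show "v ^ e = r" by (rule dvd_antisym)
qed

text \<open>The gap between successive e-th powers is at least 2: split (v+1)^e as v (v+1)^(e-1) +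
  (v+1)^(e-1), where the first summand is at least v^e and the second at least 2.\<close>

lemma powers_not_consecutive:
  fixes u v e :: nat
  assumes "v > 0" "e \<ge> 2"
  shows "u ^ e \<noteq> Suc (v ^ e)"
proof
  assume eq: "u ^ e = Suc (v ^ e)"
  hence "v ^ e < u ^ e" by simp
  hence "Suc v \<le> u" using power_less_imp_less_base[of v e u] by simp
  hence "Suc v ^ e \<le> u ^ e" by (simp add: power_mono)
  obtain e' where e: "e = Suc (Suc e')" using assms(2) by (metis Suc_le_D numeral_2_eq_2 Suc_le_mono)
  have "Suc v ^ Suc e' > v ^ Suc e'" by (intro power_strict_mono) auto
  moreover have "v ^ Suc e' \<ge> 1" using assms(1) by simp
  ultimately have "Suc v ^ Suc e' \<ge> 2" by linarith
  moreover have "Suc v ^ e = v * Suc v ^ Suc e' + Suc v ^ Suc e'" by (simp add: e)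
  moreover have "v * Suc v ^ Suc e' \<ge> v * v ^ Suc e'" by (intro mult_left_mono power_mono) auto
  moreover have "v ^ e = v * v ^ Suc e'" by (simp add: e)
  ultimately have "Suc v ^ e \<ge> v ^ e + 2" by linarith
  with eq \<open>Suc v ^ e \<le> u ^ e\<close> show False by simp
qed

locale consecutive_radical =
  fixes \<alpha> :: real and p r d :: nat
  assumes alpha_pos: "\<alpha> > 0" and d_pos: "d > 0" and p_pos: "p > 0" and r_pos: "r > 0"
    and alpha_power: "real r * \<alpha> ^ d = real p"
    and consecutive: "p = Suc r \<or> r = Suc p"
begin

lemma coprime_p_r: "coprime p r"
  using consecutive by auto

text \<open>If \<alpha>^k were rational, so would be \<alpha>^g for g = gcd(k, d). Raising it to the
  power e = d/g \<ge> 2 gives p/r in lowest terms, so the consecutive integers p and r would both be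
  e-th powers.\<close>

lemma power_irrational:
  assumes "0 < k" "k < d"
  shows "\<alpha> ^ k \<notin> \<rat>"
proof
  assume rat: "\<alpha> ^ k \<in> \<rat>"
  define g where "g = gcd k d"
  have "0 < g" "g \<le> k" using assms by (auto simp: g_def)
  obtain e where e: "d = g * e" unfolding g_def by (metis dvdE gcd_dvd2)
  have "e \<ge> 2"
  proof (rule ccontr)
    assume "\<not> e \<ge> 2"
    hence "e = 0 \<or> e = 1" by auto
    thus False using e assms \<open>g \<le> k\<close> by auto
  qed
  obtain x y where xy: "k * x = d * y + g"
    using bezout_nat[of k d] assms by (auto simp: g_def)
  have ad: "\<alpha> ^ d = real p / real r" using alpha_power r_pos by (simp add: field_simps)
  have "\<alpha> ^ g = (\<alpha> ^ k) ^ x / (\<alpha> ^ d) ^ y"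
    using alpha_pos by (simp add: power_mult[symmetric] xy power_add)
  hence "\<alpha> ^ g \<in> \<rat>" unfolding ad using rat by (simp add: Rats_power)
  then obtain u v where uv: "v \<noteq> 0" "\<bar>\<alpha> ^ g\<bar> = real u / real v" "coprime u v"
    using Rats_abs_nat_div_natE by metis
  hence ag: "\<alpha> ^ g = real u / real v" using alpha_pos by simp
  have "(real u / real v) ^ e = real p / real r"
    by (metis ad ag e power_mult)
  hence "real (u ^ e * r) = real (v ^ e * p)" using uv(1) r_pos by (simp add: field_simps)
  hence "u ^ e * r = v ^ e * p" by (simp only: of_nat_eq_iff)
  hence "u ^ e = p" "v ^ e = r"
    using coprime_power_eq_fraction[OF _ uv(3) coprime_p_r] by auto
  \<comment> \<open>When r = p + 1, \<open>u\<close> is the smaller base, whose positivity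
    \<open>powers_not_consecutive\<close> requires.\<close>
  moreover have "u > 0" using \<open>u ^ e = p\<close> p_pos \<open>e \<ge> 2\<close> by (cases u) (auto simp: power_0_left)
  ultimately show False
    using consecutive powers_not_consecutive[of v e u] powers_not_consecutive[of u e v] uv(1) \<open>e \<ge> 2\<close>
    by auto
qed

section \<open>Integer polynomials vanishing at \<alpha>\<close>

abbreviation ev :: "int poly \<Rightarrow> real" where
  "ev f \<equiv> poly (of_int_poly f) \<alpha>"

text \<open>Up to a rational factor this is the minimal polynomial of \<alpha>, as
  \<open>degree_ge_of_root\<close> shows.\<close>

definition relator :: "int poly" where
  "relator = monom (int r) d - [:int p:]"

lemma poly_relator: "poly (of_int_poly relator) (z :: 'a :: comm_ring_1) = of_nat r * z ^ d - of_nat p"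
  by (simp add: relator_def hom_distribs poly_monom)

lemma ev_relator: "ev relator = 0"
  using alpha_power by (simp add: poly_relator)

lemma coeff_relator: "coeff relator i = (if i = d then int r else if i = 0 then - int p else 0)"
  using d_pos by (auto simp: relator_def coeff_pCons split: nat.splits)

lemma degree_relator: "degree relator = d"
  using r_pos by (intro antisym degree_le le_degree) (auto simp: coeff_relator)

lemma relator_nz: "relator \<noteq> 0"
  using degree_relator d_pos by auto

lemma content_relator: "content relator = 1"
proof -
  have "content relator dvd int r" "content relator dvd int p"
    using content_dvd_coeff[of relator d] content_dvd_coeff[of relator 0] d_pos
    by (auto simp: coeff_relator)
  moreover have "coprime (int p) (int r)" using coprime_p_r by simp
  ultimately have "is_unit (content relator)" by (meson coprime_common_divisor)
  thus ?thesis by (metis is_unit_normalize normalize_content)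
qed

text \<open>A nonzero integer polynomial m of least degree k vanishing at \<alpha> divides a
  multiple of \<open>relator\<close>, so all its complex roots have modulus \<alpha>. The modulus of
  their product is the rational number |m(0) / lc(m)|, so \<alpha>^k is rational, which is
  impossible for 0 < k < d.\<close>

lemma degree_ge_of_root:
  assumes "f \<noteq> 0" "ev f = 0"
  shows "d \<le> degree f"
proof (rule ccontr)
  assume less: "\<not> d \<le> degree f"
  define Q where "Q = (\<lambda>k. \<exists>f. f \<noteq> 0 \<and> ev f = 0 \<and> degree f = k)"
  define k where "k = (LEAST k. Q k)"
  have "Q (degree f)" using assms by (auto simp: Q_def)
  hence "Q k" "k \<le> degree f" unfolding k_def by (auto intro: LeastI Least_le)
  then obtain m where m: "m \<noteq> 0" "ev m = 0" "degree m = k" by (auto simp: Q_def)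
  have "k < d" using less \<open>k \<le> degree f\<close> by simp
  have "0 < k"
  proof (rule ccontr)
    assume "\<not> 0 < k"
    then obtain c where "m = [:c:]" using m(3) by (metis degree_eq_zeroE gr0I)
    with m show False by auto
  qed
  \<comment> \<open>Pseudo-division keeps the coefficients integral; by minimality of k the
    remainder must vanish.\<close>
  obtain a q where aq: "a \<noteq> 0" "Polynomial.smult a relator = m * q + pseudo_mod relator m"
    and deg: "pseudo_mod relator m = 0 \<or> degree (pseudo_mod relator m) < degree m"
    using pseudo_mod[OF m(1), of relator] by auto
  have "ev (Polynomial.smult a relator) = 0" by (simp add: hom_distribs ev_relator)
  hence "ev (pseudo_mod relator m) = 0" unfolding aq(2) using m(2) by (simp add: hom_distribs)
  hence "pseudo_mod relator m = 0"
    using deg m(3) not_less_Least[of "degree (pseudo_mod relator m)" Q]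
    by (metis Q_def \<open>ev (pseudo_mod relator m) = 0\<close> k_def)
  hence am: "Polynomial.smult a relator = m * q" using aq by simp
  define mc where "mc = (of_int_poly m :: complex poly)"
  obtain root where root: "Polynomial.smult (lead_coeff mc) (\<Prod>i<degree mc. [:-root i, 1:]) = mc"
    using complex_poly_decompose' by blast
  have dm: "degree mc = k" by (simp add: mc_def m)
  have norm_root: "norm (root i) = \<alpha>" if "i < k" for i
  proof -
    have "poly mc (root i) = 0"
      by (subst root[symmetric]) (use that dm in \<open>auto simp: poly_prod\<close>)
    hence "poly (of_int_poly (m * q)) (root i) = 0" by (simp add: mc_def hom_distribs)
    hence "of_int a * poly (of_int_poly relator) (root i) = 0" by (simp add: am[symmetric] hom_distribs)
    hence "of_nat r * root i ^ d = (of_nat p :: complex)" using aq(1) by (simp add: poly_relator)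
    hence "norm (of_nat r * root i ^ d) = norm (of_nat p :: complex)" by simp
    hence "real r * norm (root i) ^ d = real p" by (simp add: norm_mult norm_power)
    hence "norm (root i) ^ d = \<alpha> ^ d" using alpha_power r_pos by (metis mult_left_cancel of_nat_eq_0_iff less_irrefl)
    thus ?thesis using d_pos alpha_pos by (simp add: power_eq_iff_eq_base)
  qed
  \<comment> \<open>Evaluation at 0 expresses the constant coefficient through the product of the
    roots.\<close>
  have "poly mc 0 = lead_coeff mc * (\<Prod>i<k. - root i)"
    by (subst root[symmetric]) (simp add: poly_prod dm)
  hence "norm (poly mc 0) = norm (lead_coeff mc) * (\<Prod>i<k. norm (root i))"
    by (simp add: norm_mult prod_norm[symmetric])
  also have "\<dots> = norm (lead_coeff mc) * \<alpha> ^ k" by (simp add: norm_root)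
  finally have "norm (of_int (coeff m 0) :: complex) = norm (of_int (lead_coeff m) :: complex) * \<alpha> ^ k"
    by (simp add: mc_def poly_0_coeff_0)
  hence "\<alpha> ^ k = \<bar>of_int (coeff m 0)\<bar> / \<bar>of_int (lead_coeff m)\<bar>"
    using m(1) by (simp add: field_simps norm_of_int)
  also have "\<dots> \<in> \<rat>" by simp
  finally show False using power_irrational[OF \<open>0 < k\<close> \<open>k < d\<close>] by simp
qed

text \<open>The pseudo-remainder modulo \<open>relator\<close> vanishes at \<alpha> and has degree
  below d, hence is zero. As \<open>relator\<close> is primitive, multiplicativity of the content
  (Gauss's lemma) makes the multiplier \<open>a\<close> divide the quotient, so it can be
  cancelled.\<close>

lemma relator_dvd:
  assumes "ev f = 0"
  shows "relator dvd f"
proof -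
  obtain a q where aq: "a \<noteq> 0" "Polynomial.smult a f = relator * q + pseudo_mod f relator"
    and deg: "pseudo_mod f relator = 0 \<or> degree (pseudo_mod f relator) < degree relator"
    using pseudo_mod[OF relator_nz, of f] by auto
  have "ev (Polynomial.smult a f) = 0" by (simp add: hom_distribs assms)
  hence "ev (pseudo_mod f relator) = 0" unfolding aq(2) using ev_relator by (simp add: hom_distribs)
  hence "pseudo_mod f relator = 0"
    using deg degree_ge_of_root[of "pseudo_mod f relator"] degree_relator by fastforce
  hence af: "Polynomial.smult a f = relator * q" using aq by simp
  have "normalize a * content f = content q"
    using arg_cong[OF af, of content] by (simp add: content_mult content_relator)
  hence "a dvd content q" by (metis dvd_triv_left normalize_dvd_iff)
  hence "[:a:] dvd q" by (simp add: const_poly_dvd_iff_dvd_content)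
  then obtain q' where "q = Polynomial.smult a q'" by (auto elim!: dvdE)
  hence "Polynomial.smult a (f - relator * q') = 0" using af by (simp add: smult_diff_right)
  hence "f = relator * q'" using aq(1) by simp
  thus ?thesis by simp
qed

end

section \<open>Catenary degrees and factorizations into powers\<close>

lemma fact_dist_commute: "fact_dist x y = fact_dist y x"
  by (simp add: fact_dist_def subset_mset.inf_commute max.commute)

text \<open>The common part \<open>u\<close> lies in the gcd; the gcd may be larger when
  \<open>x\<close> and \<open>y\<close> overlap, whence an inequality.\<close>

lemma fact_dist_common_part: "fact_dist (u + x) (u + y) \<le> max (size x) (size y)"
proof -
  have "u \<subseteq># (u + x) \<inter># (u + y)" by simp
  hence "size u \<le> size ((u + x) \<inter># (u + y))" by (rule size_mset_mono)
  thus ?thesis by (auto simp: fact_dist_def)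
qed

text \<open>A surplus of one atom survives removal of the gcd. Subtraction is truncated, so bounding
  the absolute difference takes both orders of \<open>x\<close> and \<open>y\<close>.\<close>

lemma count_diff_le_fact_dist: "count x a - count y a \<le> fact_dist x y"
proof -
  have "count x a - count y a = count (x - y) a" by simp
  also have "\<dots> \<le> size (x - y)" by (rule count_le_size)
  also have "\<dots> = size x - size (x \<inter># y)"
    by (metis diff_intersect_left_idem size_Diff_submset subset_mset.inf_le1)
  also have "\<dots> \<le> fact_dist x y" by (simp add: fact_dist_def)
  finally show ?thesis .
qed

text \<open>A single link of an N-chain, so that chains can be built as a reflexive transitive
  closure.\<close>

definition close_factorizations ::
    "'a :: comm_monoid_add set \<Rightarrow> 'a \<Rightarrow> nat \<Rightarrow> 'a multiset \<Rightarrow> 'a multiset \<Rightarrow> bool" where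
  "close_factorizations M b N x y \<longleftrightarrow>
     x \<in> factorizations M b \<and> y \<in> factorizations M b \<and> fact_dist x y \<le> N"

lemma chain_connected_refl:
  assumes "x \<in> factorizations M b"
  shows "chain_connected M b N x x"
  unfolding chain_connected_def
  by (rule exI[of _ 0], rule exI[of _ "\<lambda>_. x"]) (use assms in auto)

lemma chain_connected_of_rtranclp:
  assumes "(close_factorizations M b N)\<^sup>*\<^sup>* x y" "x \<in> factorizations M b"
  shows "chain_connected M b (enat N) x y"
  using assms
proof (induction rule: rtranclp_induct)
  case base
  thus ?case by (rule chain_connected_refl)
next
  case (step y z)
  from step.IH[OF step.prems] obtain k :: nat and c where c: "\<forall>i\<le>k. c i \<in> factorizations M b"
    "\<forall>i\<in>{1..k}. enat (fact_dist (c (i - 1)) (c i)) \<le> enat N" "c 0 = x" "c k = y"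
    unfolding chain_connected_def by blast
  define c' where "c' = c(Suc k := z)"
  have "c' 0 = x" "c' (Suc k) = z" using c by (simp_all add: c'_def)
  moreover have "\<forall>i\<le>Suc k. c' i \<in> factorizations M b"
    using c step.hyps by (auto simp: c'_def le_Suc_eq close_factorizations_def)
  moreover have "\<forall>i\<in>{1..Suc k}. enat (fact_dist (c' (i - 1)) (c' i)) \<le> enat N"
    using c step.hyps by (auto simp: c'_def close_factorizations_def le_Suc_eq)
  ultimately show ?case unfolding chain_connected_def by blast
qed

text \<open>A chain with distinct ends must move somewhere, and the link where it moves is the
  required pair; otherwise it would be constant.\<close>

lemma chain_connected_imp_close:
  assumes "chain_connected M b N x y" "x \<noteq> y"
  shows "\<exists>x' y'. x' \<in> factorizations M b \<and> y' \<in> factorizations M b \<and> x' \<noteq> y' \<and>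
           enat (fact_dist x' y') \<le> N"
proof (rule ccontr)
  assume far: "\<not> ?thesis"
  obtain k :: nat and c where c: "\<forall>i\<le>k. c i \<in> factorizations M b"
    "\<forall>i\<in>{1..k}. enat (fact_dist (c (i - 1)) (c i)) \<le> N" "c 0 = x" "c k = y"
    using assms(1) unfolding chain_connected_def by blast
  have "c i = x" if "i \<le> k" for i
    using that
  proof (induction i)
    case (Suc i)
    from Suc.prems have "enat (fact_dist (c i) (c (Suc i))) \<le> N" using bspec[OF c(2), of "Suc i"] by simp
    moreover have "c i \<in> factorizations M b" "c (Suc i) \<in> factorizations M b" using c(1) Suc.prems by auto
    ultimately have "c i = c (Suc i)" using far by blast
    thus ?case using Suc by simp
  qed (use c in simp)
  thus False using assms(2) c(4) by auto
qed

lemma catenary_degree_elem_connects: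
  "\<forall>x \<in> factorizations M b. \<forall>y \<in> factorizations M b.
     chain_connected M b (catenary_degree_elem M b) x y"
proof -
  have "chain_connected M b \<infinity> x y"
    if "x \<in> factorizations M b" "y \<in> factorizations M b" for x y
    unfolding chain_connected_def
    by (rule exI[of _ 1], rule exI[of _ "\<lambda>i. if i = 0 then x else y"]) (use that in auto)
  hence "\<forall>x \<in> factorizations M b. \<forall>y \<in> factorizations M b. chain_connected M b \<infinity> x y" by blast
  from LeastI[of "\<lambda>n. \<forall>x \<in> factorizations M b. \<forall>y \<in> factorizations M b. chain_connected M b n x y", OF this]
  show ?thesis unfolding catenary_degree_elem_def .
qed

text \<open>The upper bound is connectedness by N-chains. For the lower bound, any chain between the
  two distinct factorizations of \<open>b\<close> has a nontrivial link, which spans a distance of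
  at least N.\<close>

lemma catenary_degree_eqI:
  assumes connected: "\<And>b x y. x \<in> factorizations M b \<Longrightarrow> y \<in> factorizations M b \<Longrightarrow>
      chain_connected M b (enat N) x y"
    and far: "\<And>b x y. x \<in> factorizations M b \<Longrightarrow> y \<in> factorizations M b \<Longrightarrow> x \<noteq> y \<Longrightarrow>
      N \<le> fact_dist x y"
    and two: "b \<in> M" "x \<in> factorizations M b" "y \<in> factorizations M b" "x \<noteq> y"
  shows "catenary_degree M = enat N"
proof (rule antisym)
  show "catenary_degree M \<le> enat N"
    unfolding catenary_degree_def catenary_degree_elem_def
    by (rule SUP_least, rule Least_le) (auto intro: connected)
  have "chain_connected M b (catenary_degree_elem M b) x y"
    using catenary_degree_elem_connects two by blast
  from chain_connected_imp_close[OF this two(4)] obtain x' y' where xy: "x' \<in> factorizations M b" "y' \<in> factorizations M b" "x' \<noteq> y'"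
    "enat (fact_dist x' y') \<le> catenary_degree_elem M b"
    by blast
  have "enat N \<le> enat (fact_dist x' y')" using far xy by simp
  also note xy(4)
  also have "catenary_degree_elem M b \<le> catenary_degree M"
    unfolding catenary_degree_def using two(1) by (rule SUP_upper)
  finally show "enat N \<le> catenary_degree M" .
qed

lemma catenary_degree_unique_factorization:
  assumes "\<And>b x y. x \<in> factorizations M b \<Longrightarrow> y \<in> factorizations M b \<Longrightarrow> x = y"
  shows "catenary_degree M = 0"
proof -
  have "chain_connected M b 0 x y"
    if "x \<in> factorizations M b" "y \<in> factorizations M b" for b x y
    using assms[OF that] chain_connected_refl[OF that(1)] by simp
  hence "catenary_degree_elem M b \<le> 0" for b
    unfolding catenary_degree_elem_def by (intro Least_le) auto
  hence "catenary_degree M \<le> 0" unfolding catenary_degree_def by (rule SUP_least)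
  thus ?thesis by simp
qed

section \<open>Multisets of exponents as polynomials with nonnegative coefficients\<close>

text \<open>Coefficients are taken in the integers so that two such polynomials can be subtracted
  and divided by \<open>relator\<close>.\<close>

definition exponent_poly :: "nat multiset \<Rightarrow> int poly" where
  "exponent_poly z = (\<Sum>i\<in>#z. monom 1 i)"

definition power_value :: "real \<Rightarrow> nat multiset \<Rightarrow> real" where
  "power_value \<alpha> z = (\<Sum>i\<in>#z. \<alpha> ^ i)"

lemma exponent_poly_simps [simp]:
  "exponent_poly {#} = 0" "exponent_poly (add_mset i z) = monom 1 i + exponent_poly z"
  "exponent_poly (x + y) = exponent_poly x + exponent_poly y"
  by (simp_all add: exponent_poly_def)

lemma power_value_simps [simp]:
  "power_value \<alpha> {#} = 0" "power_value \<alpha> (add_mset i z) = \<alpha> ^ i + power_value \<alpha> z"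
  "power_value \<alpha> (x + y) = power_value \<alpha> x + power_value \<alpha> y"
  "power_value \<alpha> (replicate_mset n i) = real n * \<alpha> ^ i"
  by (simp_all add: power_value_def)

lemma coeff_exponent_poly [simp]: "coeff (exponent_poly z) i = int (count z i)"
  by (induction z) auto

lemma exponent_poly_replicate [simp]: "exponent_poly (replicate_mset n i) = monom (int n) i"
  by (rule poly_eqI) (simp add: count_replicate_mset)

lemma exponent_poly_inject [simp]: "exponent_poly x = exponent_poly y \<longleftrightarrow> x = y"
  by (metis coeff_exponent_poly multiset_eqI of_nat_eq_iff)

lemma poly_exponent_poly: "poly (of_int_poly (exponent_poly z)) \<alpha> = power_value \<alpha> z"
  by (induction z) (simp_all add: hom_distribs poly_monom)

text \<open>One inclusion follows Horner's scheme: raising all exponents by one multiplies the value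
  by \<alpha>, and copies of the exponent 0 supply the constant term. The other adds one monomial at
  a time.\<close>

lemma nat_eval_monoid_altdef: "nat_eval_monoid \<alpha> = range (power_value \<alpha>)"
proof (intro equalityI subsetI)
  fix x assume "x \<in> nat_eval_monoid \<alpha>"
  then obtain q :: "nat poly" where "x = poly (map_poly real q) \<alpha>" by (auto simp: nat_eval_monoid_def)
  moreover have "\<exists>z. poly (map_poly real q) \<alpha> = power_value \<alpha> z"
  proof (induction q)
    case (pCons a q)
    then obtain z where z: "poly (map_poly real q) \<alpha> = power_value \<alpha> z" by blast
    have "power_value \<alpha> (image_mset Suc z) = \<alpha> * power_value \<alpha> z"
      by (simp add: power_value_def sum_mset_distrib_left image_mset.compositionality o_def)
    hence "poly (map_poly real (pCons a q)) \<alpha> = power_value \<alpha> (replicate_mset a 0 + image_mset Suc z)"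
      using pCons.hyps by (simp add: map_poly_pCons z)
    thus ?case by blast
  qed (auto intro: exI[of _ "{#}"])
  ultimately show "x \<in> range (power_value \<alpha>)" by auto
next
  fix x assume "x \<in> range (power_value \<alpha>)"
  then obtain z where "x = power_value \<alpha> z" by auto
  moreover have "\<exists>q :: nat poly. power_value \<alpha> z = poly (map_poly real q) \<alpha>"
  proof (induction z)
    case (add i z)
    then obtain q :: "nat poly" where q: "power_value \<alpha> z = poly (map_poly real q) \<alpha>" by blast
    have "map_poly real (monom 1 i + q) = monom 1 i + map_poly real q"
      by (intro poly_eqI) (simp add: coeff_map_poly)
    hence "power_value \<alpha> (add_mset i z) = poly (map_poly real (monom 1 i + q)) \<alpha>"
      by (simp add: q poly_monom)
    thus ?case by blast
  qed (auto intro: exI[of _ 0])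
  ultimately show "x \<in> nat_eval_monoid \<alpha>" by (auto simp: nat_eval_monoid_def)
qed

lemma power_value_in_monoid [simp]: "power_value \<alpha> z \<in> nat_eval_monoid \<alpha>"
  by (simp add: nat_eval_monoid_altdef)

lemma nat_eval_monoid_add:
  "x \<in> nat_eval_monoid \<alpha> \<Longrightarrow> y \<in> nat_eval_monoid \<alpha> \<Longrightarrow> x + y \<in> nat_eval_monoid \<alpha>"
  unfolding nat_eval_monoid_altdef by (auto simp flip: power_value_simps(3))

lemma power_value_nonneg: "\<alpha> > 0 \<Longrightarrow> power_value \<alpha> z \<ge> 0"
  by (induction z) auto

lemma power_value_pos: "\<alpha> > 0 \<Longrightarrow> z \<noteq> {#} \<Longrightarrow> power_value \<alpha> z > 0"
  by (cases z) (auto intro!: add_pos_nonneg power_value_nonneg)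

text \<open>A representation with two or more terms splits into its first power and the rest, both
  positive, so an atom has only one term.\<close>

lemma atoms_are_powers:
  assumes "\<alpha> > 0"
  shows "atoms (nat_eval_monoid \<alpha>) \<subseteq> range (power \<alpha>)"
proof
  fix a assume a: "a \<in> atoms (nat_eval_monoid \<alpha>)"
  then obtain z where z: "a = power_value \<alpha> z" "a \<noteq> 0"
    by (auto simp: atoms_def nat_eval_monoid_altdef)
  then obtain n w where w: "z = add_mset n w" by (cases z) auto
  have "w = {#}"
  proof (rule ccontr)
    assume "w \<noteq> {#}"
    hence "power_value \<alpha> {#n#} \<noteq> 0" "power_value \<alpha> w \<noteq> 0"
      using power_value_pos[OF assms, of w] assms by auto
    moreover have "a = power_value \<alpha> {#n#} + power_value \<alpha> w" using z w by simp
    ultimately show False using a power_value_in_monoid[of \<alpha>] unfolding atoms_def by blast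
  qed
  thus "a \<in> range (power \<alpha>)" using z w by simp
qed

text \<open>Atoms being powers of \<alpha>, an exponent can be chosen for each; this moves questions
  about factorizations to multisets of exponents.\<close>

lemma factorization_lift:
  assumes "\<alpha> > 0" "x \<in> factorizations (nat_eval_monoid \<alpha>) b"
  obtains z where "x = image_mset (power \<alpha>) z" "power_value \<alpha> z = b"
proof -
  have "set_mset x \<subseteq> range (power \<alpha>)" using assms atoms_are_powers by (auto simp: factorizations_def)
  hence "x = image_mset (power \<alpha>) (image_mset (inv_into UNIV (power \<alpha>)) x)"
    by (simp add: image_mset.compositionality o_def f_inv_into_f subset_iff cong: image_mset_cong)
  moreover have "sum_mset x = b" using assms by (simp add: factorizations_def)
  ultimately show ?thesis using that unfolding power_value_def by metis
qed

text \<open>A splitting into two nonzero elements would combine their representations into one with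
  at least two terms.\<close>

lemma power_atomI:
  assumes "\<alpha> > 0" "\<And>z. power_value \<alpha> z = \<alpha> ^ n \<Longrightarrow> size z \<le> 1"
  shows "\<alpha> ^ n \<in> atoms (nat_eval_monoid \<alpha>)"
proof -
  have "\<alpha> ^ n \<noteq> x + y" if M: "x \<in> nat_eval_monoid \<alpha>" "y \<in> nat_eval_monoid \<alpha>" "x \<noteq> 0" "y \<noteq> 0" for x y
  proof
    assume eq: "\<alpha> ^ n = x + y"
    obtain z1 z2 where z: "x = power_value \<alpha> z1" "y = power_value \<alpha> z2"
      using M by (metis nat_eval_monoid_altdef rangeE)
    hence "size (z1 + z2) \<le> 1" using eq assms(2)[of "z1 + z2"] by simp
    moreover have "z1 \<noteq> {#}" "z2 \<noteq> {#}" using z M by auto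
    hence "size z1 \<ge> 1" "size z2 \<ge> 1" by (simp_all add: Suc_leI nonempty_has_size)
    ultimately show False by simp
  qed
  moreover have "\<alpha> ^ n \<in> nat_eval_monoid \<alpha>"
    using power_value_in_monoid[of \<alpha> "{#n#}"] by simp
  ultimately show ?thesis using assms(1) by (auto simp: atoms_def)
qed

lemma atomicI_powers:
  assumes "\<And>z. \<exists>w. power_value \<alpha> w = power_value \<alpha> z \<and> power \<alpha> ` set_mset w \<subseteq> atoms (nat_eval_monoid \<alpha>)"
  shows "atomic (nat_eval_monoid \<alpha>)"
  unfolding atomic_def
proof (intro ballI impI)
  fix b assume "b \<in> nat_eval_monoid \<alpha>"
  then obtain z where z: "b = power_value \<alpha> z" by (auto simp: nat_eval_monoid_altdef)
  obtain w where "power_value \<alpha> w = b" "power \<alpha> ` set_mset w \<subseteq> atoms (nat_eval_monoid \<alpha>)"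
    using assms[of z] z by auto
  hence "image_mset (power \<alpha>) w \<in> factorizations (nat_eval_monoid \<alpha>) b"
    by (simp add: factorizations_def power_value_def)
  thus "factorizations (nat_eval_monoid \<alpha>) b \<noteq> {}" by blast
qed

section \<open>The nonintegral case\<close>

context consecutive_radical
begin

text \<open>The recurrence behind the sign arguments below: each coefficient of the product involves
  only two coefficients of \<open>g\<close>, at distance d.\<close>

lemma coeff_relator_mult:
  "coeff (relator * g) i = (if d \<le> i then int r * coeff g (i - d) else 0) - int p * coeff g i"
proof -
  have "relator * g = monom (int r) d * g - Polynomial.smult (int p) g"
    by (simp add: relator_def algebra_simps)
  thus ?thesis by (simp add: coeff_monom_mult)
qed

text \<open>The quotient \<open>g\<close> records how one representation turns into the other: its
  coefficient at i is the net number of trades of p copies of \<alpha>^i for r copies of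
  \<alpha>^(i+d).\<close>

lemma equal_values:
  assumes "power_value \<alpha> z = power_value \<alpha> z'"
  obtains g where "exponent_poly z' = exponent_poly z + relator * g"
proof -
  have "ev (exponent_poly z' - exponent_poly z) = 0"
    using assms by (simp add: hom_distribs poly_exponent_poly)
  hence "relator dvd exponent_poly z' - exponent_poly z" by (rule relator_dvd)
  then obtain g where "exponent_poly z' - exponent_poly z = relator * g" by (elim dvdE)
  hence "exponent_poly z' = exponent_poly z + relator * g" by simp
  thus ?thesis by (rule that)
qed

text \<open>Upward induction on i: once the coefficient of \<open>g\<close> at i - d is nonpositive,
  a positive one at i would push the product's coefficient down to -p or lower.\<close>

lemma quotient_nonpos:
  assumes "\<And>i. coeff (relator * g) i > - int p"
  shows "coeff g i \<le> 0"
proof (induction i rule: less_induct)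
  case (less i)
  have "(if d \<le> i then int r * coeff g (i - d) else 0) \<le> 0"
    using less[of "i - d"] d_pos by (auto simp: mult_le_0_iff)
  with assms[of i] have "int p * coeff g i < int p * 1" by (auto simp: coeff_relator_mult)
  hence "coeff g i < 1" by (rule mult_less_cancel_left_pos[THEN iffD1, rotated]) (use p_pos in simp)
  thus ?case by simp
qed

text \<open>The mirror image of \<open>quotient_nonpos\<close>: downward induction from the degree,
  reading the product's coefficient at i + d.\<close>

lemma quotient_nonneg:
  assumes "\<And>i. coeff (relator * g) i > - int r"
  shows "coeff g i \<ge> 0"
proof (induction "degree g - i" arbitrary: i rule: less_induct)
  case less
  show ?case
  proof (cases "i > degree g")
    case True
    thus ?thesis by (simp add: coeff_eq_0)
  next
    case False
    have "coeff g (i + d) \<ge> 0"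
    \<comment> \<open>The truncated measure does not drop at i = \<open>degree g\<close>, but there
      i + d already lies beyond the degree.\<close>
    proof (cases "i = degree g")
      case True
      thus ?thesis using d_pos by (simp add: coeff_eq_0)
    next
      case neq: False
      thus ?thesis using less[of "i + d"] False d_pos by simp
    qed
    hence "int p * coeff g (i + d) \<ge> 0" by simp
    with assms[of "i + d"] have "int r * coeff g i > int r * (-1)" by (simp add: coeff_relator_mult)
    hence "- 1 < coeff g i" by (rule mult_less_cancel_left_pos[THEN iffD1, rotated]) (use r_pos in simp)
    thus ?thesis by simp
  qed
qed

text \<open>With all multiplicities below p and r no trade is possible in either direction: the two
  sign lemmas force \<open>g\<close> to vanish.\<close>

lemma power_value_unique:
  assumes "\<And>i. count z i < min p r" "power_value \<alpha> z = power_value \<alpha> z'"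
  shows "z' = z"
proof -
  obtain g where g: "exponent_poly z' = exponent_poly z + relator * g"
    using equal_values[OF assms(2)] .
  have "coeff (relator * g) i = int (count z' i) - int (count z i)" for i
    using arg_cong[OF g, of "\<lambda>f. coeff f i"] by simp
  moreover have "int (count z i) < int p" "int (count z i) < int r" for i
    using assms(1)[of i] by simp_all
  ultimately have "coeff (relator * g) i > - int p" "coeff (relator * g) i > - int r" for i
    by (smt (verit) of_nat_0_le_iff)+
  hence "coeff g i = 0" for i using quotient_nonpos quotient_nonneg by (metis antisym)
  hence "g = 0" by (simp add: poly_eq_iff)
  thus ?thesis using g by simp
qed

text \<open>At the lowest nonzero coefficient of \<open>g\<close> the shifted copy contributes
  nothing, leaving a nonzero multiple of p.\<close>

lemma coeff_ge_p:
  assumes "g \<noteq> 0"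
  shows "\<exists>i. \<bar>coeff (relator * g) i\<bar> \<ge> int p"
proof -
  have ex: "\<exists>i. coeff g i \<noteq> 0" using assms leading_coeff_0_iff by blast
  define i where "i = (LEAST i. coeff g i \<noteq> 0)"
  have "coeff g i \<noteq> 0" unfolding i_def using ex by (rule LeastI_ex)
  moreover have "coeff g j = 0" if "j < i" for j using not_less_Least that unfolding i_def by blast
  ultimately have "\<bar>coeff (relator * g) i\<bar> = int p * \<bar>coeff g i\<bar>" "\<bar>coeff g i\<bar> \<ge> 1"
    using d_pos by (auto simp: coeff_relator_mult abs_mult)
  thus ?thesis by (metis mult_left_mono mult.right_neutral of_nat_0_le_iff)
qed

text \<open>At the top index only the leading coefficient of \<open>g\<close> times r
  remains.\<close>

lemma coeff_ge_r:
  assumes "g \<noteq> 0"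
  shows "\<exists>i. \<bar>coeff (relator * g) i\<bar> \<ge> int r"
proof -
  have "lead_coeff g \<noteq> 0" using assms by simp
  hence "\<bar>lead_coeff g\<bar> \<ge> 1" by linarith
  moreover have "\<bar>coeff (relator * g) (degree g + d)\<bar> = int r * \<bar>lead_coeff g\<bar>"
    using d_pos by (auto simp: coeff_relator_mult abs_mult coeff_eq_0)
  ultimately show ?thesis by (metis mult_left_mono mult.right_neutral of_nat_0_le_iff)
qed

text \<open>At the least i where \<open>g\<close> is positive, the contribution from i - d is
  nonpositive, so passing from \<open>z\<close> to \<open>z'\<close> loses at least p copies of i.
  Hence \<open>z\<close> contains them, and trading them lowers the coefficient of \<open>g\<close>
  at i by one.\<close>

lemma exchange_available:
  assumes "exponent_poly z' = exponent_poly z + relator * g" "\<exists>i. coeff g i > 0"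
  obtains w i where "z = w + replicate_mset p i" "coeff g i > 0"
    "exponent_poly z' = exponent_poly (w + replicate_mset r (i + d)) + relator * (g - monom 1 i)"
proof -
  define i where "i = (LEAST i. coeff g i > 0)"
  have i: "coeff g i > 0" unfolding i_def using assms(2) by (rule LeastI_ex)
  have low: "coeff g j \<le> 0" if "j < i" for j using not_less_Least that unfolding i_def by force
  have "(if d \<le> i then int r * coeff g (i - d) else 0) \<le> 0"
    using low[of "i - d"] d_pos by (auto simp: mult_le_0_iff)
  moreover have "int (count z' i) = int (count z i) + coeff (relator * g) i"
    using arg_cong[OF assms(1), of "\<lambda>f. coeff f i"] by simp
  moreover have "int p * coeff g i \<ge> int p * 1" using i by (intro mult_left_mono) auto
  ultimately have "p \<le> count z i" by (auto simp: coeff_relator_mult split: if_splits)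
  hence "replicate_mset p i \<subseteq># z" by (simp add: count_le_replicate_mset_subset_eq)
  then obtain w where w: "z = w + replicate_mset p i" by (metis subset_mset.diff_add)
  have "relator * monom 1 i = monom (int r) (i + d) - monom (int p) i"
    by (rule poly_eqI) (auto simp: coeff_relator_mult)
  hence "exponent_poly z' = exponent_poly (w + replicate_mset r (i + d)) + relator * (g - monom 1 i)"
    by (simp add: assms(1) w right_diff_distrib)
  thus ?thesis using w i that by blast
qed

end

section \<open>Atoms and catenary degree for p, r \<ge> 2\<close>

locale nonintegral_radical = consecutive_radical +
  assumes p_ge: "p \<ge> 2" and r_ge: "r \<ge> 2"
begin

abbreviation "M \<equiv> nat_eval_monoid \<alpha>"

text \<open>The bounds p, r \<ge> 2 make the multiplicity 1 small enough for
  \<open>power_value_unique\<close>.\<close>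

lemma power_value_eq_power:
  assumes "power_value \<alpha> z = \<alpha> ^ n"
  shows "z = {#n#}"
proof (rule power_value_unique)
  show "power_value \<alpha> {#n#} = power_value \<alpha> z" using assms by simp
qed (use p_ge r_ge in auto)

lemma inj_power: "inj (power \<alpha>)"
proof
  fix m n assume "\<alpha> ^ m = \<alpha> ^ n"
  hence "{#m#} = {#n#}" using power_value_eq_power[of "{#m#}" n] by simp
  thus "m = n" by simp
qed

lemma atoms_eq_powers: "atoms M = range (power \<alpha>)"
proof (intro equalityI atoms_are_powers alpha_pos subsetI)
  fix x assume "x \<in> range (power \<alpha>)"
  then obtain n where "x = \<alpha> ^ n" by auto
  moreover have "\<alpha> ^ n \<in> atoms M"
    using alpha_pos by (rule power_atomI) (auto dest: power_value_eq_power)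
  ultimately show "x \<in> atoms M" by simp
qed

lemma atomic_monoid: "atomic M"
  by (rule atomicI_powers) (use atoms_eq_powers in blast)

lemma image_factorization:
  "image_mset (power \<alpha>) z \<in> factorizations M b \<longleftrightarrow> power_value \<alpha> z = b"
  by (auto simp: factorizations_def atoms_eq_powers power_value_def)

text \<open>Distinct factorizations have a nonzero quotient \<open>g\<close>. Coefficients of
  \<open>relator * g\<close> are differences of multiplicities, and its two extreme ones have
  absolute values at least p and r.\<close>

lemma fact_dist_ge:
  assumes "x \<in> factorizations M b" "y \<in> factorizations M b" "x \<noteq> y"
  shows "max p r \<le> fact_dist x y"
proof -
  obtain z z' where z: "x = image_mset (power \<alpha>) z" "power_value \<alpha> z = b"
    and z': "y = image_mset (power \<alpha>) z'" "power_value \<alpha> z' = b"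
    using assms factorization_lift[OF alpha_pos] by metis
  obtain g where g: "exponent_poly z' = exponent_poly z + relator * g"
    using equal_values[of z z'] z z' by metis
  have "g \<noteq> 0" using g assms(3) z z' by auto
  have c: "coeff (relator * g) i = int (count z' i) - int (count z i)" for i
    using arg_cong[OF g, of "\<lambda>f. coeff f i"] by simp
  have image: "count (image_mset (power \<alpha>) u) (\<alpha> ^ i) = count u i" for u i
    using inj_power by (induction u) (auto dest: injD)
  have "\<bar>coeff (relator * g) i\<bar> \<le> int (fact_dist x y)" for i
    using count_diff_le_fact_dist[of x "\<alpha> ^ i" y] count_diff_le_fact_dist[of y "\<alpha> ^ i" x]
    unfolding c z z' image fact_dist_commute[of "image_mset (power \<alpha>) z'"] by linarith
  hence "int p \<le> int (fact_dist x y)" "int r \<le> int (fact_dist x y)"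
    using coeff_ge_p[OF \<open>g \<noteq> 0\<close>] coeff_ge_r[OF \<open>g \<noteq> 0\<close>] by (meson order_trans)+
  thus ?thesis by simp
qed

lemma power_value_exchange:
  "power_value \<alpha> (w + replicate_mset r (i + d)) = power_value \<alpha> (w + replicate_mset p i)"
proof -
  have "real r * \<alpha> ^ (i + d) = real r * \<alpha> ^ d * \<alpha> ^ i" by (simp add: power_add)
  thus ?thesis by (simp add: alpha_power)
qed

text \<open>Induction on the sum of the absolute values of the coefficients of \<open>g\<close>,
  which every trade lowers by one. The fixed bound \<open>N\<close> keeps the range of summation the
  same throughout.\<close>

lemma powers_connected:
  assumes "exponent_poly z' = exponent_poly z + relator * g" "degree g \<le> N"
    "power_value \<alpha> z = b" "power_value \<alpha> z' = b"
  shows "(close_factorizations M b (max p r))\<^sup>*\<^sup>* (image_mset (power \<alpha>) z) (image_mset (power \<alpha>) z')"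
  using assms
proof (induction "nat (\<Sum>i\<le>N. \<bar>coeff g i\<bar>)" arbitrary: z z' g rule: less_induct)
  case less
  define R where "R = close_factorizations M b (max p r)"
  \<comment> \<open>Stated for any \<open>h\<close> of the same norm as \<open>g\<close>, to serve
    both \<open>g\<close> and, with the ends interchanged, \<open>- g\<close>.\<close>
  have step: "R\<^sup>*\<^sup>* (image_mset (power \<alpha>) u) (image_mset (power \<alpha>) u')"
    if h: "exponent_poly u' = exponent_poly u + relator * h" "degree h \<le> N"
      "power_value \<alpha> u = b" "power_value \<alpha> u' = b" "\<exists>i. coeff h i > 0"
      "(\<Sum>i\<le>N. \<bar>coeff h i\<bar>) = (\<Sum>i\<le>N. \<bar>coeff g i\<bar>)" for u u' h
  proof -
    obtain w i where w: "u = w + replicate_mset p i" and i: "coeff h i > 0"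
      and u': "exponent_poly u' = exponent_poly (w + replicate_mset r (i + d)) + relator * (h - monom 1 i)"
      using exchange_available[OF h(1,5)] by metis
    define v where "v = w + replicate_mset r (i + d)"
    have v: "power_value \<alpha> v = b" using power_value_exchange w h(3) by (simp only: v_def)
    have "i \<le> N" using i h(2) le_degree[of h i] by simp
    have "(\<Sum>j\<le>N. \<bar>coeff (h - monom 1 i) j\<bar>) < (\<Sum>j\<le>N. \<bar>coeff h j\<bar>)"
      by (rule sum_strict_mono_ex1) (use \<open>i \<le> N\<close> i in auto)
    moreover have "0 \<le> (\<Sum>j\<le>N. \<bar>coeff (h - monom 1 i) j\<bar>)" by (simp add: sum_nonneg)
    ultimately have "nat (\<Sum>j\<le>N. \<bar>coeff (h - monom 1 i) j\<bar>) < nat (\<Sum>j\<le>N. \<bar>coeff g j\<bar>)"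
      using h(6) by linarith
    moreover have "degree (h - monom 1 i) \<le> N"
      using h(2) \<open>i \<le> N\<close> by (intro degree_diff_le) (auto simp: degree_monom_eq)
    ultimately have "R\<^sup>*\<^sup>* (image_mset (power \<alpha>) v) (image_mset (power \<alpha>) u')"
      using less.hyps[of "h - monom 1 i" u' v] u' v h(4) unfolding R_def v_def by blast
    moreover have "R (image_mset (power \<alpha>) u) (image_mset (power \<alpha>) v)"
    proof -
      have "fact_dist (image_mset (power \<alpha>) u) (image_mset (power \<alpha>) v) \<le> max p r"
        using fact_dist_common_part[of "image_mset (power \<alpha>) w"
            "image_mset (power \<alpha>) (replicate_mset p i)" "image_mset (power \<alpha>) (replicate_mset r (i + d))"]
        by (simp add: w v_def)
      thus ?thesis using h(3) v by (simp add: R_def close_factorizations_def image_factorization)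
    qed
    ultimately show ?thesis by (rule converse_rtranclp_into_rtranclp[rotated])
  qed
  have "symp R" by (auto simp: R_def close_factorizations_def fact_dist_commute intro: sympI)
  hence sym: "symp (R\<^sup>*\<^sup>*)" by (rule symp_rtranclp)
  consider "\<exists>i. coeff g i > 0" | "\<exists>i. coeff (- g) i > 0" | "g = 0"
    by (metis coeff_minus neg_0_less_iff_less linorder_neqE_linordered_idom leading_coeff_0_iff)
  thus ?case unfolding R_def[symmetric]
  proof cases
    case 1
    thus "R\<^sup>*\<^sup>* (image_mset (power \<alpha>) z) (image_mset (power \<alpha>) z')" using step less.prems by blast
  next
    case 2
    have "exponent_poly z = exponent_poly z' + relator * (- g)" using less.prems(1) by simp
    hence "R\<^sup>*\<^sup>* (image_mset (power \<alpha>) z') (image_mset (power \<alpha>) z)"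
      by (rule step) (use 2 less.prems in auto)
    thus "R\<^sup>*\<^sup>* (image_mset (power \<alpha>) z) (image_mset (power \<alpha>) z')" using sym by (meson sympD)
  next
    case 3
    thus "R\<^sup>*\<^sup>* (image_mset (power \<alpha>) z) (image_mset (power \<alpha>) z')" using less.prems(1) by simp
  qed
qed

lemma catenary_degree_eq: "catenary_degree M = enat (max p r)"
proof (rule catenary_degree_eqI)
  fix b x y assume xy: "x \<in> factorizations M b" "y \<in> factorizations M b"
  obtain z z' where z: "x = image_mset (power \<alpha>) z" "power_value \<alpha> z = b"
    and z': "y = image_mset (power \<alpha>) z'" "power_value \<alpha> z' = b"
    using xy factorization_lift[OF alpha_pos] by metis
  obtain g where "exponent_poly z' = exponent_poly z + relator * g"
    using equal_values[of z z'] z z' by metis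
  from powers_connected[OF this order_refl z(2) z'(2)] show "chain_connected M b (enat (max p r)) x y"
    using chain_connected_of_rtranclp xy(1) z(1) z'(1) by blast
next
  \<comment> \<open>The element p = r \<alpha>^d has two factorizations, p copies of 1 and r copies
    of \<alpha>^d, of different lengths because p and r differ.\<close>
  show "power_value \<alpha> (replicate_mset p 0) \<in> M" by (rule power_value_in_monoid)
  have "power_value \<alpha> (replicate_mset r d) = power_value \<alpha> (replicate_mset p 0)"
    using alpha_power by simp
  thus "image_mset (power \<alpha>) (replicate_mset p 0) \<in> factorizations M (power_value \<alpha> (replicate_mset p 0))"
    "image_mset (power \<alpha>) (replicate_mset r d) \<in> factorizations M (power_value \<alpha> (replicate_mset p 0))"
    by (simp_all only: image_factorization)
  have "size (replicate_mset p 0) \<noteq> size (replicate_mset r d)" using consecutive by auto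
  thus "image_mset (power \<alpha>) (replicate_mset p 0) \<noteq> image_mset (power \<alpha>) (replicate_mset r d)"
    by (metis size_image_mset)
qed (rule fact_dist_ge)

section \<open>Ascending chains of principal ideals\<close>

text \<open>Each generator is the other plus an element of \<open>M\<close>, and elements of
  \<open>M\<close> are nonnegative.\<close>

lemma principal_ideal_inject:
  assumes "principal_ideal M b = principal_ideal M c"
  shows "b = c"
proof -
  have z: "0 \<in> M" using power_value_in_monoid[of \<alpha> "{#}"] by simp
  have ge: "x \<ge> 0" if "x \<in> M" for x
    using that power_value_nonneg[OF alpha_pos] by (auto simp: nat_eval_monoid_altdef)
  have "b \<in> principal_ideal M c" "c \<in> principal_ideal M b"
    using z assms by (force simp: principal_ideal_def)+
  then obtain x y where "x \<in> M" "y \<in> M" "b = c + x" "c = b + y" by (auto simp: principal_ideal_def)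
  thus ?thesis using ge[of x] ge[of y] by linarith
qed

text \<open>With r = p + 1, the relation gives p \<alpha>^(id) = r \<alpha>^((i+1)d) = p
  \<alpha>^((i+1)d) + \<alpha>^((i+1)d), so the ideals of these elements ascend strictly.\<close>

lemma not_ACCP:
  assumes "p < r"
  shows "\<not> ACCP M"
proof
  assume accp: "ACCP M"
  define b where "b = (\<lambda>i. real p * \<alpha> ^ (i * d))"
  have r: "r = Suc p" using assms consecutive by auto
  have b_step: "b i = b (Suc i) + \<alpha> ^ (Suc i * d)" for i
  proof -
    have "b i = real r * \<alpha> ^ d * \<alpha> ^ (i * d)" using alpha_power by (simp add: b_def)
    thus ?thesis by (simp add: b_def r power_add algebra_simps)
  qed
  have "range b \<subseteq> M"
    using power_value_in_monoid[of \<alpha> "replicate_mset p (i * d)" for i] by (auto simp: b_def)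
  moreover have "principal_ideal M (b i) \<subseteq> principal_ideal M (b (Suc i))" for i
  proof
    fix x assume "x \<in> principal_ideal M (b i)"
    then obtain y where y: "y \<in> M" "x = b i + y" by (auto simp: principal_ideal_def)
    have "power_value \<alpha> {#Suc i * d#} + y \<in> M" by (intro nat_eval_monoid_add power_value_in_monoid y(1))
    moreover have "x = b (Suc i) + (power_value \<alpha> {#Suc i * d#} + y)"
      using y(2) b_step[of i] by simp
    ultimately show "x \<in> principal_ideal M (b (Suc i))" unfolding principal_ideal_def by blast
  qed
  ultimately obtain N where N: "\<forall>i\<ge>N. principal_ideal M (b i) = principal_ideal M (b N)"
    using accp unfolding ACCP_def by blast
  have "b (Suc N) = b N" by (rule principal_ideal_inject, rule N[rule_format]) simp
  thus False using b_step[of N] alpha_pos by simp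
qed

text \<open>Here \<alpha> \<ge> 1, so nonzero elements are at least 1 and every change of generator
  along the chain lowers it by at least 1.\<close>

lemma ACCP_holds:
  assumes "r < p"
  shows "ACCP M"
  unfolding ACCP_def
proof (intro allI impI, elim conjE)
  fix b assume b: "range b \<subseteq> M" and chain: "\<forall>i. principal_ideal M (b i) \<subseteq> principal_ideal M (b (Suc i))"
  have "\<alpha> \<ge> 1"
  proof (rule ccontr)
    assume "\<not> \<alpha> \<ge> 1"
    hence "\<alpha> ^ d \<le> 1" using alpha_pos by (intro power_le_one) auto
    hence "real r * \<alpha> ^ d \<le> real r" by (simp add: mult_left_le)
    thus False using alpha_power assms by simp
  qed
  have ge_1: "x \<ge> 1" if M: "x \<in> M" "x \<noteq> 0" for x
  proof -
    obtain z where z: "x = power_value \<alpha> z" using M(1) unfolding nat_eval_monoid_altdef by blast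
    with M obtain n w where "z = add_mset n w" by (cases z) auto
    moreover have "1 \<le> \<alpha> ^ n" using \<open>\<alpha> \<ge> 1\<close> by (rule one_le_power)
    ultimately show ?thesis using z power_value_nonneg[OF alpha_pos, of w] by simp
  qed
  have zero: "0 \<in> M" using power_value_in_monoid[of \<alpha> "{#}"] by simp
  have step: "b (Suc i) = b i \<or> b (Suc i) \<le> b i - 1" for i
  proof -
    have "b i \<in> principal_ideal M (b (Suc i))"
      using chain[rule_format, of i] zero by (force simp: principal_ideal_def)
    then obtain x where "x \<in> M" "b i = b (Suc i) + x" by (auto simp: principal_ideal_def)
    thus ?thesis using ge_1[of x] by (cases "x = 0") auto
  qed
  have nonneg: "b i \<ge> 0" for i
  proof -
    have "b i \<in> range (power_value \<alpha>)" using b unfolding nat_eval_monoid_altdef by blast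
    thus ?thesis using power_value_nonneg[OF alpha_pos] by auto
  qed
  \<comment> \<open>A drop by 1 lowers the integer part, so the generators are constant from an
    index where the integer part is least.\<close>
  define f where "f = (\<lambda>i. nat \<lfloor>b i\<rfloor>)"
  define k where "k = (LEAST k. k \<in> range f)"
  have "k \<in> range f" unfolding k_def by (rule LeastI[of _ "f 0"]) simp
  then obtain N where N: "f N = k" by auto
  have "b i = b N" if "i \<ge> N" for i
    using that
  proof (induction i rule: dec_induct)
    case (step i)
    have "\<not> b (Suc i) \<le> b i - 1"
    proof
      assume "b (Suc i) \<le> b i - 1"
      hence "f (Suc i) < f N" using nonneg[of "Suc i"] step.IH unfolding f_def by linarith
      moreover have "k \<le> f (Suc i)" unfolding k_def by (rule Least_le) simp
      ultimately show False using N by simp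
    qed
    thus ?case using \<open>b (Suc i) = b i \<or> b (Suc i) \<le> b i - 1\<close> step.IH by simp
  qed simp
  hence "\<forall>i\<ge>N. principal_ideal M (b i) = principal_ideal M (b N)" by metis
  thus "\<exists>N. \<forall>i\<ge>N. principal_ideal M (b i) = principal_ideal M (b N)" ..
qed

end

section \<open>Dimension of the rationalization of an additive group of reals\<close>

text \<open>The additive extension of (q, g) \<mapsto> q g to formal sums; it will induce a rational
  linear map on the tensor product that detects independence.\<close>

definition tensor_eval :: "((rat \<times> real) \<Rightarrow>\<^sub>0 int) \<Rightarrow> real" where
  "tensor_eval x = (\<Sum>k\<in>Poly_Mapping.keys x.
     of_int (Poly_Mapping.lookup x k) * (of_rat (fst k) * snd k))"

lemma tensor_eval_superset:
  assumes "finite S" "Poly_Mapping.keys x \<subseteq> S"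
  shows "tensor_eval x = (\<Sum>k\<in>S. of_int (Poly_Mapping.lookup x k) * (of_rat (fst k) * snd k))"
  unfolding tensor_eval_def
  by (rule sum.mono_neutral_left) (use assms in \<open>auto simp: in_keys_iff\<close>)

lemma tensor_eval_0 [simp]: "tensor_eval 0 = 0"
  by (simp add: tensor_eval_def)

lemma tensor_eval_frag_of [simp]: "tensor_eval (frag_of (q, g)) = of_rat q * g"
  by (simp add: tensor_eval_def)

lemma tensor_eval_diff [simp]: "tensor_eval (x - y) = tensor_eval x - tensor_eval y"
proof -
  define S where "S = Poly_Mapping.keys x \<union> Poly_Mapping.keys y"
  have S: "finite S" "Poly_Mapping.keys x \<subseteq> S" "Poly_Mapping.keys y \<subseteq> S"
    "Poly_Mapping.keys (x - y) \<subseteq> S"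
    using keys_diff[of x y] by (auto simp: S_def)
  show ?thesis
    by (simp add: tensor_eval_superset[OF S(1,2)] tensor_eval_superset[OF S(1,3)]
        tensor_eval_superset[OF S(1,4)] lookup_minus sum_subtractf[symmetric] left_diff_distrib)
qed

lemma tensor_eval_uminus [simp]: "tensor_eval (- x) = - tensor_eval x"
  using tensor_eval_diff[of 0 x] by simp

lemma tensor_eval_add [simp]: "tensor_eval (x + y) = tensor_eval x + tensor_eval y"
  using tensor_eval_diff[of x "- y"] by simp

lemma tensor_eval_rat_scale: "tensor_eval (rat_scale q x) = of_rat q * tensor_eval x"
proof (rule frag_induction[where S = UNIV and P = "\<lambda>x. tensor_eval (rat_scale q x) = of_rat q * tensor_eval x"])
  fix k :: "rat \<times> real"
  show "tensor_eval (rat_scale q (frag_of k)) = of_rat q * tensor_eval (frag_of k)"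
    by (cases k) (simp add: of_rat_mult)
qed (simp_all add: right_diff_distrib)

lemma common_denominator:
  fixes c :: "'a \<Rightarrow> rat"
  assumes "finite I"
  shows "\<exists>D :: int. D > 0 \<and> (\<forall>i\<in>I. \<exists>z :: int. of_int D * c i = of_int z)"
  using assms
proof (induction I)
  case empty
  show ?case by (intro exI[of _ 1]) simp
next
  case (insert j I)
  then obtain D :: int where D: "D > 0" "\<And>i. i \<in> I \<Longrightarrow> \<exists>z :: int. of_int D * c i = of_int z" by blast
  obtain a b where ab: "quotient_of (c j) = (a, b)" by (cases "quotient_of (c j)")
  have b: "b > 0" "c j = of_int a / of_int b"
    using quotient_of_denom_pos[OF ab] quotient_of_div[OF ab] by auto
  have "\<exists>z :: int. of_int (D * b) * c i = of_int z" if "i \<in> insert j I" for i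
  proof (cases "i = j")
    case True
    thus ?thesis using b by (intro exI[of _ "D * a"]) simp
  next
    case False
    with that have "i \<in> I" by simp
    from D(2)[OF this] obtain z :: int where "of_int D * c i = of_int z" by blast
    thus ?thesis by (intro exI[of _ "b * z"]) (simp add: mult_ac)
  qed
  thus ?case using D(1) b(1) by (intro exI[of _ "D * b"]) auto
qed

text \<open>Clearing a common denominator turns a rational relation into an integral one.\<close>

lemma rational_independence:
  fixes e :: "nat \<Rightarrow> real"
  assumes indep: "\<And>c :: nat \<Rightarrow> int. (\<Sum>i<d. of_int (c i) * e i) = 0 \<Longrightarrow> \<forall>i<d. c i = 0"
    and zero: "(\<Sum>i<d. of_rat (c i) * e i) = 0" and "i < d"
  shows "c i = 0"
proof -
  obtain D :: int where D: "D > 0" "\<forall>i\<in>{..<d}. \<exists>z :: int. of_int D * c i = of_int z"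
    using common_denominator[of "{..<d}" c] by blast
  then obtain z where z: "\<And>i. i < d \<Longrightarrow> of_int D * c i = of_int (z i)" by (metis lessThan_iff)
  have zr: "of_int (z i) = of_int D * (of_rat (c i) :: real)" if "i < d" for i
    using arg_cong[OF z[OF that], of "of_rat :: rat \<Rightarrow> real"] by (simp add: of_rat_mult)
  have "(\<Sum>i<d. of_int (z i) * e i) = (\<Sum>i<d. of_int D * (of_rat (c i) * e i))"
    by (rule sum.cong) (auto simp: zr)
  also have "\<dots> = 0" using zero by (simp add: sum_distrib_left[symmetric])
  finally have "z i = 0" using indep \<open>i < d\<close> by blast
  thus ?thesis using z[OF \<open>i < d\<close>] D(1) by simp
qed

section \<open>A basis of the rationalization\<close>

text \<open>The \<open>e i\<close> freely generate a subgroup containing a positive multiple of each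
  element of \<open>G\<close>; after tensoring with the rationals such a family becomes a
  basis.\<close>

context
  fixes G :: "real set" and e :: "nat \<Rightarrow> real" and d :: nat
  assumes add: "\<And>x y. x \<in> G \<Longrightarrow> y \<in> G \<Longrightarrow> x + y \<in> G"
    and uminus: "\<And>x. x \<in> G \<Longrightarrow> - x \<in> G" and zero: "0 \<in> G"
    and e_in: "\<And>i. i < d \<Longrightarrow> e i \<in> G"
    and indep: "\<And>c :: nat \<Rightarrow> int. (\<Sum>i<d. of_int (c i) * e i) = 0 \<Longrightarrow> \<forall>i<d. c i = 0"
    and spans: "\<And>g. g \<in> G \<Longrightarrow>
      \<exists>(n :: nat) (c :: nat \<Rightarrow> int). n > 0 \<and> real n * g = (\<Sum>i<d. of_int (c i) * e i)"
begin

private abbreviation "K \<equiv> tensor_relations G"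
private abbreviation "F \<equiv> free_tensor G"
private abbreviation "V \<equiv> rat_tensor G"
private abbreviation coset where "coset x \<equiv> K #>\<^bsub>F\<^esub> x"
private abbreviation pure where "pure q g \<equiv> coset (frag_of (q, g))"
private abbreviation B where "B \<equiv> (\<lambda>i. pure 1 (e i)) ` {..<d}"

text \<open>Multiplication of reals is biadditive, so evaluation kills the generating
  relations.\<close>

private lemma tensor_eval_relations: "x \<in> K \<Longrightarrow> tensor_eval x = 0"
  unfolding tensor_relations_def
proof (induction x rule: generate.induct)
  case (inv h)
  hence "h \<in> carrier F" using tensor_generators_subset[of G, OF add] by blast
  thus ?case using inv by (auto simp: free_tensor_inv[of G, OF add] of_rat_add ring_distribs)
qed (auto simp: free_tensor_mult[of G, OF add] free_tensor_one[of G, OF add] of_rat_add ring_distribs)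

text \<open>Any representative gives the same value, because evaluation vanishes on
  \<open>K\<close>.\<close>

private definition coset_eval :: "((rat \<times> real) \<Rightarrow>\<^sub>0 int) set \<Rightarrow> real" where
  "coset_eval X = tensor_eval (SOME x. x \<in> X)"

private lemma coset_eval: "coset_eval (coset x) = tensor_eval x"
proof -
  have "x \<in> coset x"
    using tensor_relations_0[of G, OF add] by (auto simp: tensor_coset[of G, OF add] intro: exI[of _ 0])
  hence "(SOME y. y \<in> coset x) \<in> coset x" by (rule someI)
  then obtain k where "k \<in> K" "(SOME y. y \<in> coset x) = k + x" by (auto simp: tensor_coset[of G, OF add])
  thus ?thesis by (simp add: coset_eval_def tensor_eval_relations)
qed

interpretation V: vectorspace class_ring V
  by (rule vectorspace_rat_tensor[OF add])

private lemma coset_eval_add: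
  assumes "X \<in> carrier V" "Y \<in> carrier V"
  shows "coset_eval (X \<oplus>\<^bsub>V\<^esub> Y) = coset_eval X + coset_eval Y"
proof -
  obtain x y where "X = coset x" "x \<in> carrier F" "Y = coset y" "y \<in> carrier F"
    using assms rat_tensor_carrierE[of G, OF add] by metis
  thus ?thesis by (simp add: rat_tensor_add[of G, OF add] coset_eval)
qed

private lemma coset_eval_smult:
  assumes "X \<in> carrier V"
  shows "coset_eval (q \<odot>\<^bsub>V\<^esub> X) = of_rat q * coset_eval X"
proof -
  obtain x where "X = coset x" "x \<in> carrier F"
    using assms rat_tensor_carrierE[of G, OF add] by metis
  thus ?thesis by (simp add: rat_tensor_smult[of G, OF add] coset_eval tensor_eval_rat_scale)
qed

private lemma coset_eval_zero: "coset_eval \<zero>\<^bsub>V\<^esub> = 0"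
  using coset_eval_add[of "\<zero>\<^bsub>V\<^esub>" "\<zero>\<^bsub>V\<^esub>"] by simp

private lemma coset_eval_lincomb:
  assumes "finite A" "A \<subseteq> carrier V"
  shows "coset_eval (V.lincomb a A) = (\<Sum>v\<in>A. of_rat (a v) * coset_eval v)"
  using assms
proof (induction A)
  case empty
  thus ?case by (simp add: V.lincomb_def coset_eval_zero)
next
  case (insert v A)
  have "V.lincomb a (insert v A) = a v \<odot>\<^bsub>V\<^esub> v \<oplus>\<^bsub>V\<^esub> V.lincomb a A"
    unfolding V.lincomb_def using insert by (intro V.finsum_insert) auto
  moreover have "a v \<odot>\<^bsub>V\<^esub> v \<in> carrier V" using insert by auto
  moreover have "V.lincomb a A \<in> carrier V" using insert by (intro V.lincomb_closed) auto
  ultimately show ?case using insert by (simp add: coset_eval_add coset_eval_smult)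
qed

private lemma pure_closed: "g \<in> G \<Longrightarrow> pure q g \<in> carrier V"
  by (rule rat_tensor_in_carrier[of G, OF add]) (auto simp: frag_of_in_free_tensor[of G, OF add])

private lemma B_subset: "B \<subseteq> carrier V"
  using pure_closed e_in by auto

text \<open>Needed to know that the set \<open>B\<close> has d elements. Equal cosets evaluate to
  equal \<open>e i\<close> and \<open>e j\<close>, a nontrivial integral relation unless i =
  j.\<close>

private lemma inj_B: "inj_on (\<lambda>i. pure 1 (e i)) {..<d}"
proof (rule inj_onI)
  fix i j assume ij: "i \<in> {..<d}" "j \<in> {..<d}" "pure 1 (e i) = pure 1 (e j)"
  have pure_eval: "coset_eval (pure 1 (e k)) = e k" for k by (simp add: coset_eval)
  have "e i = e j" using arg_cong[OF ij(3), of coset_eval] unfolding pure_eval .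
  define c :: "nat \<Rightarrow> int" where "c = (\<lambda>k. (if k = i then 1 else 0) - (if k = j then 1 else 0))"
  have "(\<Sum>k<d. of_int (c k) * e k) = (\<Sum>k<d. (if k = i then e k else 0) - (if k = j then e k else 0))"
    by (rule sum.cong) (auto simp: c_def)
  also have "\<dots> = 0" using ij(1,2) \<open>e i = e j\<close> by (simp add: sum_subtractf)
  finally have "c i = 0" using indep ij(1) by blast
  thus "i = j" by (auto simp: c_def split: if_splits)
qed

text \<open>Evaluation carries a vanishing combination of \<open>B\<close> to a rational relation
  among the \<open>e i\<close>.\<close>

private lemma B_independent: "V.lin_indpt B"
proof (rule V.finite_lin_indpt2)
  fix a assume "V.lincomb a B = \<zero>\<^bsub>V\<^esub>"
  hence "(\<Sum>v\<in>B. of_rat (a v) * coset_eval v) = 0"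
    using coset_eval_lincomb[of B a] B_subset coset_eval_zero by simp
  hence lin: "(\<Sum>i<d. of_rat (a (pure 1 (e i))) * e i) = 0"
    by (simp add: sum.reindex[OF inj_B] coset_eval)
  have "a (pure 1 (e i)) = 0" if "i < d" for i
    using rational_independence[where c = "\<lambda>i. a (pure 1 (e i))", OF indep lin that] .
  thus "\<forall>v\<in>B. a v = \<zero>\<^bsub>class_ring\<^esub>" by (auto simp: class_ring_simps)
qed (use B_subset in auto)

private lemma pure_add:
  assumes "g \<in> G" "h \<in> G"
  shows "pure q (g + h) = pure q g \<oplus>\<^bsub>V\<^esub> pure q h"
proof -
  have "frag_of (q, g + h) - frag_of (q, g) - frag_of (q, h) \<in> K"
    unfolding tensor_relations_def by (rule generate.incl) (use assms in auto)
  hence "frag_of (q, g + h) - (frag_of (q, g) + frag_of (q, h)) \<in> K" by (simp add: diff_diff_eq)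
  from tensor_coset_eqI[of G, OF add this] show ?thesis
    using assms by (simp add: rat_tensor_add[of G, OF add] frag_of_in_free_tensor[of G, OF add])
qed

private lemma pure_add_left:
  assumes "g \<in> G"
  shows "pure (q + r) g = pure q g \<oplus>\<^bsub>V\<^esub> pure r g"
proof -
  have "frag_of (q + r, g) - frag_of (q, g) - frag_of (r, g) \<in> K"
    unfolding tensor_relations_def by (rule generate.incl) (use assms in auto)
  hence "frag_of (q + r, g) - (frag_of (q, g) + frag_of (r, g)) \<in> K" by (simp add: diff_diff_eq)
  from tensor_coset_eqI[of G, OF add this] show ?thesis
    using assms by (simp add: rat_tensor_add[of G, OF add] frag_of_in_free_tensor[of G, OF add])
qed

private lemma pure_smult: "q \<odot>\<^bsub>V\<^esub> pure r g = pure (q * r) g"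
  by (simp add: rat_tensor_smult[of G, OF add])

private lemma pure_0: "pure q 0 = \<zero>\<^bsub>V\<^esub>"
proof -
  have "pure q 0 \<oplus>\<^bsub>V\<^esub> pure q 0 = pure q 0" using pure_add[OF zero zero, of q] by simp
  thus ?thesis using pure_closed[OF zero, of q] by simp
qed

private lemma pure_0_left:
  assumes "g \<in> G"
  shows "pure 0 g = \<zero>\<^bsub>V\<^esub>"
proof -
  have "pure 0 g \<oplus>\<^bsub>V\<^esub> pure 0 g = pure 0 g" using pure_add_left[OF assms, of 0 0] by simp
  thus ?thesis using pure_closed[OF assms, of 0] by simp
qed

private lemma multiple_in: "g \<in> G \<Longrightarrow> real n * g \<in> G"
  by (induction n) (auto simp: zero add distrib_right)

private lemma pure_multiple:
  assumes "g \<in> G"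
  shows "pure q (real n * g) = pure (of_nat n * q) g"
proof (induction n)
  case 0
  thus ?case using assms by (simp add: pure_0 pure_0_left)
next
  case (Suc n)
  have "pure q (g + real n * g) = pure (q + of_nat n * q) g"
    using assms by (simp add: pure_add multiple_in Suc pure_add_left)
  thus ?case by (simp add: distrib_right)
qed

text \<open>The elements whose tensors with all rationals lie in the span form a subgroup
  \<open>T\<close> containing every \<open>e i\<close>, hence also some n g with n > 0. Dividing on
  the other side, the tensor of q and g equals that of q/n and n g.\<close>

private lemma spanned_pure:
  assumes "g \<in> G"
  shows "pure q g \<in> V.span B"
proof -
  interpret S: submodule class_ring "V.span B" V by (rule V.span_is_submodule[OF B_subset])
  define T where "T = {g \<in> G. \<forall>q. pure q g \<in> V.span B}"
  have T_add: "x + y \<in> T" if "x \<in> T" "y \<in> T" for x y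
    using that by (auto simp: T_def add pure_add)
  have T_zero: "0 \<in> T" by (simp add: T_def zero pure_0)
  have T_e: "e i \<in> T" if "i < d" for i
  proof -
    have "pure 1 (e i) \<in> V.span B" using V.in_own_span[OF B_subset] that by auto
    hence "q \<odot>\<^bsub>V\<^esub> pure 1 (e i) \<in> V.span B" for q
      by (intro S.smult_closed) (auto simp: class_ring_simps)
    thus ?thesis using that e_in by (simp add: T_def pure_smult)
  qed
  have T_uminus: "- x \<in> T" if "x \<in> T" for x
  proof -
    have x: "x \<in> G" using that by (simp add: T_def)
    have "pure q (- x) = pure (- q) x" for q
    proof -
      have "pure q (- x) \<oplus>\<^bsub>V\<^esub> pure q x = \<zero>\<^bsub>V\<^esub>"
        using pure_add[of "- x" x q] x by (simp add: uminus pure_0)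
      moreover have "pure (- q) x \<oplus>\<^bsub>V\<^esub> pure q x = \<zero>\<^bsub>V\<^esub>"
        using pure_add_left[OF x, of "- q" q] x by (simp add: pure_0_left)
      ultimately show ?thesis
        using x by (metis V.add.right_cancel pure_closed uminus)
    qed
    thus ?thesis using that uminus by (simp add: T_def)
  qed
  have T_nat: "real n * x \<in> T" if "x \<in> T" for x n
    using that by (induction n) (auto simp: T_zero T_add distrib_right)
  have T_int: "of_int k * x \<in> T" if "x \<in> T" for x k
    using T_nat[OF that, of "nat k"] T_uminus[OF T_nat[OF that, of "nat (- k)"]]
    by (cases "k \<ge> 0") auto
  have T_sum: "(\<Sum>i<m. of_int (c i) * e i) \<in> T" if "m \<le> d" for m c
    using that by (induction m) (auto simp: T_zero intro!: T_add T_int T_e)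
  obtain n c where nc: "n > 0" "real n * g = (\<Sum>i<d. of_int (c i) * e i)" using spans[OF assms] by blast
  have "pure (q / of_nat n) (real n * g) \<in> V.span B"
    using T_sum[of d c] nc(2) by (simp add: T_def)
  thus ?thesis using nc(1) by (simp add: pure_multiple[OF assms])
qed

private lemma B_generates: "V.span B = carrier V"
proof (intro equalityI subsetI)
  interpret S: submodule class_ring "V.span B" V by (rule V.span_is_submodule[OF B_subset])
  fix X assume "X \<in> carrier V"
  then obtain x where x: "X = coset x" "x \<in> carrier F" by (metis rat_tensor_carrierE[of G, OF add])
  have "Poly_Mapping.keys x \<subseteq> UNIV \<times> G"
    using x(2) by (simp add: free_tensor_carrier[of G, OF add])
  \<comment> \<open>Membership in the free group is carried along because adding cosets by
    representatives requires it.\<close>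
  hence "coset x \<in> V.span B \<and> x \<in> carrier F"
  proof (induction x rule: frag_induction)
    case zero
    show ?case using S.zero_closed pure_0[of 0] x(2)
      by (auto simp: free_tensor_carrier[of G, OF add] rat_tensor_def Let_def FactGroup_def tensor_coset[of G, OF add])
  next
    case (one a)
    thus ?case using spanned_pure by (cases a) (auto simp: frag_of_in_free_tensor[of G, OF add])
  next
    case (diff x y)
    have xy: "x - y \<in> carrier F" using diff.IH free_tensor_diff[of G, OF add] by blast
    have "coset (x - y) \<oplus>\<^bsub>V\<^esub> coset y = coset x"
      using xy diff.IH by (simp add: rat_tensor_add[of G, OF add])
    moreover have c: "coset (x - y) \<in> carrier V" "coset x \<in> carrier V" "coset y \<in> carrier V"
      using xy diff.IH rat_tensor_in_carrier[of G, OF add] by auto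
    ultimately have "coset (x - y) = coset x \<oplus>\<^bsub>V\<^esub> (\<ominus>\<^bsub>V\<^esub> coset y)"
      by (metis V.add.inv_solve_right)
    moreover have "\<ominus>\<^bsub>V\<^esub> coset y = (\<ominus>\<^bsub>class_ring\<^esub> \<one>\<^bsub>class_ring\<^esub>) \<odot>\<^bsub>V\<^esub> coset y"
      using c(3) by (rule V.smult_minus_1[symmetric])
    moreover have "(\<ominus>\<^bsub>class_ring\<^esub> \<one>\<^bsub>class_ring\<^esub>) \<odot>\<^bsub>V\<^esub> coset y \<in> V.span B"
      using diff.IH by (intro S.smult_closed) auto
    ultimately show ?case using xy diff.IH S.m_closed by simp
  qed
  thus "X \<in> V.span B" using x by simp
qed (use V.span_is_subset2[OF B_subset] in auto)

lemma rat_tensor_dimension: "V.fin_dim" "V.dim = d"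
proof -
  have "V.basis B" using B_independent B_generates B_subset by (simp add: V.basis_def)
  thus "V.dim = d" using V.dim_basis[of B] card_image[OF inj_B] by simp
  show "V.fin_dim" unfolding V.fin_dim_def using B_generates B_subset by blast
qed

end

section \<open>Rank and the integral case\<close>

context consecutive_radical
begin

lemma algebraic_root: "algebraic \<alpha>"
proof (rule algebraicI)
  show "poly (of_int_poly relator) \<alpha> = 0" by (rule ev_relator)
  show "of_int_poly relator \<noteq> (0 :: real poly)" using relator_nz by simp
qed simp

lemma ev_low_degree:
  assumes "degree f < d"
  shows "ev f = (\<Sum>i<d. of_int (coeff f i) * \<alpha> ^ i)"
proof -
  have "ev f = (\<Sum>i\<le>degree f. of_int (coeff f i) * \<alpha> ^ i)" by (simp add: poly_altdef)
  also have "\<dots> = (\<Sum>i<d. of_int (coeff f i) * \<alpha> ^ i)"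
    by (rule sum.mono_neutral_left) (use assms in \<open>auto simp: coeff_eq_0\<close>)
  finally show ?thesis .
qed

text \<open>An integral relation among these powers is a polynomial of degree below d vanishing at
  \<alpha>.\<close>

lemma powers_independent:
  assumes "(\<Sum>i<d. of_int (c i) * \<alpha> ^ i) = 0"
  shows "\<forall>i<d. c i = 0"
proof -
  define f where "f = (\<Sum>i<d. monom (c i) i)"
  have coeff_f: "coeff f i = (if i < d then c i else 0)" for i
    by (auto simp: f_def coeff_sum)
  have "degree f \<le> d - 1" by (rule degree_le) (auto simp: coeff_f)
  hence "degree f < d" using d_pos by linarith
  moreover have "(\<Sum>i<d. of_int (coeff f i) * \<alpha> ^ i) = (\<Sum>i<d. of_int (c i) * \<alpha> ^ i)"
    by (rule sum.cong) (auto simp: coeff_f)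
  ultimately have "f = 0" using degree_ge_of_root[of f] ev_low_degree[of f] assms by fastforce
  thus ?thesis using coeff_f by (metis coeff_0)
qed

text \<open>Pseudo-division by \<open>relator\<close> reduces a multiple of \<open>f\<close> to
  degree below d without changing its value at \<alpha>.\<close>

lemma multiple_spanned:
  "\<exists>(n :: nat) (c :: nat \<Rightarrow> int). n > 0 \<and> real n * ev f = (\<Sum>i<d. of_int (c i) * \<alpha> ^ i)"
proof -
  define m where "m = pseudo_mod f relator"
  obtain a q where aq: "a \<noteq> 0" "Polynomial.smult a f = relator * q + m"
    and deg: "m = 0 \<or> degree m < degree relator"
    using pseudo_mod[OF relator_nz, of f] unfolding m_def by auto
  have "degree m < d" using deg degree_relator d_pos by auto
  have "of_int a * ev f = ev (Polynomial.smult a f)" by (simp add: hom_distribs)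
  also have "\<dots> = ev m" unfolding aq(2) using ev_relator by (simp add: hom_distribs)
  also have "\<dots> = (\<Sum>i<d. of_int (coeff m i) * \<alpha> ^ i)" by (rule ev_low_degree) fact
  \<comment> \<open>The multiplier \<open>a\<close> may be negative; its sign is moved to the
    coefficients so that n = |a| is positive.\<close>
  finally have "of_int (sgn a) * (of_int a * ev f) = (\<Sum>i<d. of_int (sgn a * coeff m i) * \<alpha> ^ i)"
    by (simp add: sum_distrib_left mult.assoc)
  moreover have "of_int (sgn a) * (of_int a * ev f) = real (nat \<bar>a\<bar>) * ev f"
    by (cases "a > 0") (use aq(1) in \<open>auto simp: sgn_if\<close>)
  ultimately show ?thesis using aq(1)
    by (intro exI[of _ "nat \<bar>a\<bar>"] exI[of _ "\<lambda>i. sgn a * coeff m i"]) auto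
qed

lemma monoid_rank_eq: "monoid_rank (nat_eval_monoid \<alpha>) = enat d"
proof -
  define G where "G = gp (nat_eval_monoid \<alpha>)"
  have G_iff: "x \<in> G \<longleftrightarrow> (\<exists>z z'. x = power_value \<alpha> z - power_value \<alpha> z')" for x
    by (auto simp: G_def gp_def nat_eval_monoid_altdef)
  have add: "x + y \<in> G" if xy: "x \<in> G" "y \<in> G" for x y
  proof -
    obtain a b c e where "x = power_value \<alpha> a - power_value \<alpha> b" "y = power_value \<alpha> c - power_value \<alpha> e"
      using xy G_iff by meson
    hence "x + y = power_value \<alpha> (a + c) - power_value \<alpha> (b + e)" by simp
    thus ?thesis using G_iff by blast
  qed
  have uminus: "- x \<in> G" if "x \<in> G" for x
    using that unfolding G_iff by (metis minus_diff_eq)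
  have zero: "0 \<in> G" unfolding G_iff by (metis diff_self)
  have power: "\<alpha> ^ i \<in> G" for i
    unfolding G_iff by (rule exI[of _ "{#i#}"], rule exI[of _ "{#}"]) simp
  have spans: "\<exists>(n :: nat) (c :: nat \<Rightarrow> int). n > 0 \<and> real n * g = (\<Sum>i<d. of_int (c i) * \<alpha> ^ i)"
    if g: "g \<in> G" for g
  proof -
    obtain z z' where "g = power_value \<alpha> z - power_value \<alpha> z'" using g G_iff by blast
    hence "g = ev (exponent_poly z - exponent_poly z')" by (simp add: hom_distribs poly_exponent_poly)
    thus ?thesis using multiple_spanned by simp
  qed
  have "vectorspace.fin_dim class_ring (rat_tensor G)" "vectorspace.dim class_ring (rat_tensor G) = d"
    using rat_tensor_dimension[of G d "power \<alpha>", OF add uminus zero power powers_independent spans]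
    by auto
  thus ?thesis unfolding monoid_rank_def G_def by simp
qed

end

section \<open>Unique factorization when \<alpha>^d = 2\<close>

locale integral_radical = consecutive_radical +
  assumes p_eq: "p = 2" and r_eq: "r = 1"
begin

abbreviation "M \<equiv> nat_eval_monoid \<alpha>"

lemma alpha_power_2: "\<alpha> ^ d = 2"
  using alpha_power by (simp add: p_eq r_eq)

lemma low_unique:
  assumes "set_mset z \<subseteq> {..<d}" "set_mset z' \<subseteq> {..<d}" "power_value \<alpha> z = power_value \<alpha> z'"
  shows "z = z'"
proof -
  define f where "f = exponent_poly z - exponent_poly z'"
  have "coeff f i = 0" if "i > d - 1" for i
  proof -
    have "i \<notin># z" "i \<notin># z'" using that assms(1,2) by auto
    thus ?thesis by (simp add: f_def not_in_iff)
  qed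
  hence "degree f \<le> d - 1" by (intro degree_le) blast
  hence "degree f < d" using d_pos by linarith
  moreover have "ev f = 0" using assms(3) by (simp add: f_def hom_distribs poly_exponent_poly)
  ultimately have "f = 0" using degree_ge_of_root[of f] by fastforce
  thus ?thesis by (simp add: f_def)
qed

text \<open>Each \<alpha>^n equals 2^(n div d) copies of \<alpha>^(n mod d). The number of terms
  never decreases, which \<open>low_power_atom\<close> exploits.\<close>

lemma low_representative:
  obtains w where "set_mset w \<subseteq> {..<d}" "power_value \<alpha> w = power_value \<alpha> z" "size z \<le> size w"
proof -
  have "\<exists>w. set_mset w \<subseteq> {..<d} \<and> power_value \<alpha> w = power_value \<alpha> z \<and> size z \<le> size w"
  proof (induction z)
    case (add n z)
    then obtain w where w: "set_mset w \<subseteq> {..<d}" "power_value \<alpha> w = power_value \<alpha> z" "size z \<le> size w"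
      by blast
    define v where "v = replicate_mset (2 ^ (n div d)) (n mod d)"
    have "\<alpha> ^ n = \<alpha> ^ (d * (n div d) + n mod d)" by simp
    also have "\<dots> = 2 ^ (n div d) * \<alpha> ^ (n mod d)"
      by (simp only: power_add power_mult alpha_power_2)
    finally have "power_value \<alpha> v = \<alpha> ^ n" by (simp add: v_def)
    moreover have "size v \<ge> 1" by (simp add: v_def)
    moreover have "set_mset v \<subseteq> {..<d}" using d_pos by (auto simp: v_def)
    ultimately show ?case using w by (intro exI[of _ "v + w"]) auto
  qed (intro exI[of _ "{#}"], simp)
  thus ?thesis using that by blast
qed

text \<open>Reducing any representation of \<alpha>^i to exponents below d must give the single
  exponent i, so it had at most one term to begin with.\<close>

lemma low_power_atom:
  assumes "i < d"
  shows "\<alpha> ^ i \<in> atoms M"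
  using alpha_pos
proof (rule power_atomI)
  fix z assume z: "power_value \<alpha> z = \<alpha> ^ i"
  obtain w where w: "set_mset w \<subseteq> {..<d}" "power_value \<alpha> w = power_value \<alpha> z" "size z \<le> size w"
    by (rule low_representative)
  have "w = {#i#}" by (rule low_unique) (use w z assms in auto)
  thus "size z \<le> 1" using w by simp
qed

lemma high_power_not_atom:
  assumes "d \<le> n"
  shows "\<alpha> ^ n \<notin> atoms M"
proof -
  have "\<alpha> ^ n = \<alpha> ^ (d + (n - d))" using assms by simp
  also have "\<dots> = \<alpha> ^ (n - d) + \<alpha> ^ (n - d)" unfolding power_add alpha_power_2 by simp
  finally have "\<alpha> ^ n = \<alpha> ^ (n - d) + \<alpha> ^ (n - d)" .
  moreover have "\<alpha> ^ (n - d) \<in> M" using power_value_in_monoid[of \<alpha> "{#n - d#}"] by simp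
  moreover have "\<alpha> ^ (n - d) \<noteq> 0" using alpha_pos by simp
  ultimately show ?thesis unfolding atoms_def by blast
qed

lemma atomic_monoid: "atomic M"
proof (rule atomicI_powers)
  fix z
  obtain w where "set_mset w \<subseteq> {..<d}" "power_value \<alpha> w = power_value \<alpha> z"
    by (rule low_representative)
  thus "\<exists>w. power_value \<alpha> w = power_value \<alpha> z \<and> power \<alpha> ` set_mset w \<subseteq> atoms M"
    using low_power_atom by blast
qed

text \<open>Only the powers with exponent below d are atoms, and representations by these are
  unique.\<close>

lemma catenary_degree_eq: "catenary_degree M = 0"
proof (rule catenary_degree_unique_factorization)
  have low: "set_mset z \<subseteq> {..<d}" if "image_mset (power \<alpha>) z \<in> factorizations M b" for z b
  proof
    fix n assume "n \<in># z"
    hence "\<alpha> ^ n \<in> atoms M" using that by (auto simp: factorizations_def)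
    thus "n \<in> {..<d}" using high_power_not_atom by (cases "d \<le> n") auto
  qed
  fix b x y assume xy: "x \<in> factorizations M b" "y \<in> factorizations M b"
  obtain z z' where z: "x = image_mset (power \<alpha>) z" "power_value \<alpha> z = b"
    and z': "y = image_mset (power \<alpha>) z'" "power_value \<alpha> z' = b"
    using xy factorization_lift[OF alpha_pos] by metis
  have "set_mset z \<subseteq> {..<d}" "set_mset z' \<subseteq> {..<d}"
    using low[of z b] low[of z' b] xy z(1) z'(1) by simp_all
  hence "z = z'" by (rule low_unique) (simp add: z(2) z'(2))
  thus "x = y" by (simp add: z z')
qed

end

section \<open>Choice of parameters\<close>

lemma consecutive_radical_root:
  assumes "d > 0" "p > 0" "r > 0" "p = Suc r \<or> r = Suc p"
  shows "consecutive_radical (root d (real p / real r)) p r d"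
  by unfold_locales (use assms in auto)

theorem theorem5p2:
  shows "(\<forall>c :: nat. \<forall>d :: nat. c \<in> {0} \<union> {3..} \<longrightarrow> d \<ge> 1 \<longrightarrow>
            (\<exists>\<alpha> :: real. \<alpha> > 0 \<and> algebraic \<alpha> \<and>
               atomic (nat_eval_monoid \<alpha>) \<and>
               monoid_rank (nat_eval_monoid \<alpha>) = enat d \<and>
               catenary_degree (nat_eval_monoid \<alpha>) = enat c)) \<and>
         (\<forall>c :: nat. \<forall>d :: nat. c \<ge> 3 \<longrightarrow> d \<ge> 1 \<longrightarrow>
            (\<exists>\<alpha> :: real. \<alpha> > 0 \<and> algebraic \<alpha> \<and>
               monoid_rank (nat_eval_monoid \<alpha>) = enat d \<and>
               ACCP (nat_eval_monoid \<alpha>) \<and>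
               catenary_degree (nat_eval_monoid \<alpha>) = enat c) \<and>
            (c \<ge> 1 \<longrightarrow>
              (\<exists>\<alpha> :: real. \<alpha> > 0 \<and> algebraic \<alpha> \<and>
                 monoid_rank (nat_eval_monoid \<alpha>) = enat d \<and>
                 atomic (nat_eval_monoid \<alpha>) \<and>
                 \<not> ACCP (nat_eval_monoid \<alpha>) \<and>
                 catenary_degree (nat_eval_monoid \<alpha>) = enat c)))"
proof -
  have zero: "\<exists>\<alpha> > 0. algebraic \<alpha> \<and> atomic (nat_eval_monoid \<alpha>) \<and>
      monoid_rank (nat_eval_monoid \<alpha>) = enat d \<and> catenary_degree (nat_eval_monoid \<alpha>) = enat 0"
    if "d \<ge> 1" for d
  proof -
    interpret consecutive_radical "root d (real 2 / real 1)" 2 1 d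
      by (rule consecutive_radical_root) (use that in auto)
    interpret integral_radical "root d (real 2 / real 1)" 2 1 d by unfold_locales auto
    show ?thesis
      using alpha_pos algebraic_root atomic_monoid monoid_rank_eq catenary_degree_eq
      unfolding zero_enat_def by blast
  qed
  have accp: "\<exists>\<alpha> > 0. algebraic \<alpha> \<and> atomic (nat_eval_monoid \<alpha>) \<and>
      monoid_rank (nat_eval_monoid \<alpha>) = enat d \<and> ACCP (nat_eval_monoid \<alpha>) \<and>
      catenary_degree (nat_eval_monoid \<alpha>) = enat c"
    if "c \<ge> 3" "d \<ge> 1" for c d
  proof -
    \<comment> \<open>Here p = c exceeds r = c - 1, and c \<ge> 3 makes r at least 2.\<close>
    interpret consecutive_radical "root d (real c / real (c - 1))" c "c - 1" d
      by (rule consecutive_radical_root) (use that in auto)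
    interpret nonintegral_radical "root d (real c / real (c - 1))" c "c - 1" d
      by unfold_locales (use that in auto)
    have "max c (c - 1) = c" "c - 1 < c" using that by auto
    thus ?thesis
      using alpha_pos algebraic_root atomic_monoid monoid_rank_eq catenary_degree_eq ACCP_holds
      by metis
  qed
  have no_accp: "\<exists>\<alpha> > 0. algebraic \<alpha> \<and> monoid_rank (nat_eval_monoid \<alpha>) = enat d \<and>
      atomic (nat_eval_monoid \<alpha>) \<and> \<not> ACCP (nat_eval_monoid \<alpha>) \<and>
      catenary_degree (nat_eval_monoid \<alpha>) = enat c"
    if "c \<ge> 3" "d \<ge> 1" for c d
  proof -
    \<comment> \<open>Interchanging p and r keeps their maximum c but makes \<alpha> smaller than 1,
      which breaks the ACCP.\<close>
    interpret consecutive_radical "root d (real (c - 1) / real c)" "c - 1" c d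
      by (rule consecutive_radical_root) (use that in auto)
    interpret nonintegral_radical "root d (real (c - 1) / real c)" "c - 1" c d
      by unfold_locales (use that in auto)
    have "max (c - 1) c = c" "c - 1 < c" using that by auto
    thus ?thesis
      using alpha_pos algebraic_root atomic_monoid monoid_rank_eq catenary_degree_eq not_ACCP
      by metis
  qed
  show ?thesis
  proof (intro conjI allI impI)
    fix c d :: nat assume c: "c \<in> {0} \<union> {3..}" and "d \<ge> 1"
    show "\<exists>\<alpha> :: real. \<alpha> > 0 \<and> algebraic \<alpha> \<and> atomic (nat_eval_monoid \<alpha>) \<and>
       monoid_rank (nat_eval_monoid \<alpha>) = enat d \<and> catenary_degree (nat_eval_monoid \<alpha>) = enat c"
    proof (cases "c = 0")
      case True
      thus ?thesis using zero[OF \<open>d \<ge> 1\<close>] by simp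
    next
      case False
      hence "c \<ge> 3" using c by auto
      from accp[OF this \<open>d \<ge> 1\<close>] show ?thesis by blast
    qed
  qed (use accp no_accp in blast)+
qed

end
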